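(* There is an absolute constant $C>0$ such that for every integer $q\ge 3$ and every non-principal Dirichlet character $\chi$ modulo $q$, $$|L(1,\chi)|\le\left(\frac{1}{2}+C\,\frac{\log\log q}{\log q}\right)\frac{\varphi(q)}{q}\log q\,.$$ Consequently, $$\liminf_{q\to\infty}\ \max_{\chi\ne\chi_0\ (\mathrm{mod}\ q)}\frac{|L(1,\chi)|}{\log q/\log\log q}\le\frac{1}{2}e^{-\gamma}\,,$$ where the maximum is over all non-principal Dirichlet characters modulo $q$.
   Context: For a Dirichlet character $\chi$ modulo $q$, $L(s,\chi)=\sum_{n\ge1}\chi(n)n^{-s}$; for non-principal $\chi$ the series converges at $s=1$ and $L(1,\chi)=\sum_{n\ge1}\chi(n)/n$. $\chi_0$ denotes the principal character modulo $q$. $\varphi$ is Euler's totient function and $\gamma$ is Euler's constant, i.e. $\sum_{1\le k\le x}\frac1k=\log x+\gamma+O(1/x)$. *)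

theory Defs
  imports "HOL-Analysis.Analysis" "HOL-Number_Theory.Totient"
begin

definition dirichlet_character :: "nat \<Rightarrow> (int \<Rightarrow> complex) \<Rightarrow> bool" where
  "dirichlet_character q chi \<longleftrightarrow>
     (\<forall>n. chi (n + int q) = chi n) \<and>
     (\<forall>m n. chi (m * n) = chi m * chi n) \<and>
     (\<forall>n. chi n \<noteq> 0 \<longleftrightarrow> coprime n (int q))"

definition principal_character :: "nat \<Rightarrow> int \<Rightarrow> complex" where
  "principal_character q = (\<lambda>n. if coprime n (int q) then 1 else 0)"

definition nonprincipal_characters :: "nat \<Rightarrow> (int \<Rightarrow> complex) set" where
  "nonprincipal_characters q = {chi. dirichlet_character q chi \<and> chi \<noteq> principal_character q}"

text \<open>The sum over \<open>n \<ge> 1\<close> is indexed by \<open>Suc n\<close>. It is the ordered sum \<^const>\<open>suminf\<close>, because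
  at \<open>s = 1\<close> the series of a non-principal character converges only conditionally. The value is
  meaningful only where the series converges; there is no analytic continuation.\<close>

definition Dirichlet_L :: "complex \<Rightarrow> (int \<Rightarrow> complex) \<Rightarrow> complex" where
  "Dirichlet_L s chi = (\<Sum>n. chi (int (Suc n)) * of_nat (Suc n) powr (- s))"

end

theory Submission
  imports Defs "HOL-Number_Theory.Residues" "HOL-Real_Asymp.Real_Asymp"
begin

text \<open>
  Put \<open>x = sqrt q * (ln q)^3\<close> and split \<open>L(1, \<chi>)\<close> at \<open>x\<close>. By the Polya-Vinogradov inequality and partial
  summation the part beyond \<open>x\<close> is \<open>O(1 / ln q)\<close>. The part up to \<open>x\<close> is at most the sum of \<open>1 / n\<close> over
  \<open>n \<le> x\<close> coprime to \<open>q\<close>; sieving out the primes \<open>p dvd q\<close> one at a time shows that it equals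
  \<open>\<phi>(q)/q * (ln x + \<gamma> + \<Sum>p dvd q. ln p / (p - 1))\<close> up to \<open>O(2 ^ \<omega>(q) / x)\<close>, and the sum over
  \<open>p dvd q\<close> is \<open>O(ln (ln q))\<close> by a Chebyshev-type estimate. Since \<open>ln x\<close> is \<open>ln q / 2 + 3 ln (ln q)\<close>, the
  bound follows.

  For the limit inferior take \<open>q\<close> to be the product of the primes up to \<open>n\<close>. Only the following half of
  Mertens' third theorem is needed: for every \<open>c < exp \<gamma>\<close> the product of \<open>1 / (1 - 1 / p)\<close> over \<open>p \<le> n\<close>
  exceeds \<open>c * ln n\<close> for arbitrarily large \<open>n\<close>. Otherwise the logarithm of the Euler product of
  \<open>zeta(1 + \<epsilon>)\<close>, written as an integral against \<open>exp (- t)\<close>, would be at most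
  \<open>ln (1 / \<epsilon>) + ln c + (Gamma (1 + \<delta>) - 1) / \<delta> + o(1)\<close> for every \<open>\<delta> > 0\<close>; letting \<open>\<epsilon> \<longrightarrow> 0\<close> and then
  \<open>\<delta> \<longrightarrow> 0\<close> contradicts \<open>zeta(1 + \<epsilon>) \<ge> 1 / \<epsilon>\<close>, because the derivative of \<open>Gamma\<close> at 1 is \<open>- \<gamma>\<close>.
\<close>

subsection \<open>Dirichlet characters\<close>

lemma dirichlet_character_add_mult:
  assumes "dirichlet_character q chi"
  shows "chi (n + k * int q) = chi n"
proof (induction k rule: int_induct[where k = 0])
  case base
  show ?case by simp
next
  case (step1 k)
  have "chi (n + (k + 1) * int q) = chi ((n + k * int q) + int q)"
    by (simp add: algebra_simps)
  with assms step1 show ?case unfolding dirichlet_character_def by simp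
next
  case (step2 k)
  have "chi (n + k * int q) = chi ((n + (k - 1) * int q) + int q)"
    by (simp add: algebra_simps)
  with assms step2 show ?case unfolding dirichlet_character_def by simp
qed

lemma dirichlet_character_cong:
  assumes "dirichlet_character q chi" "[m = n] (mod int q)"
  shows "chi m = chi n"
proof -
  obtain k where "n = m + int q * k"
    using assms(2) by (auto simp: cong_iff_lin)
  thus ?thesis
    using dirichlet_character_add_mult[OF assms(1), of m k] by (simp add: mult.commute)
qed

lemma dirichlet_character_mult:
  "dirichlet_character q chi \<Longrightarrow> chi (m * n) = chi m * chi n"
  by (simp add: dirichlet_character_def)

lemma dirichlet_character_eq_0_iff:
  "dirichlet_character q chi \<Longrightarrow> chi n = 0 \<longleftrightarrow> \<not> coprime n (int q)"
  unfolding dirichlet_character_def by blast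

lemma dirichlet_character_1:
  assumes "dirichlet_character q chi"
  shows "chi 1 = 1"
proof -
  have "chi 1 * chi 1 = chi 1"
    using dirichlet_character_mult[OF assms, of 1 1] by simp
  moreover have "chi 1 \<noteq> 0"
    by (simp add: dirichlet_character_eq_0_iff[OF assms])
  ultimately show ?thesis by simp
qed

lemma dirichlet_character_power:
  assumes "dirichlet_character q chi"
  shows "chi (n ^ k) = chi n ^ k"
  by (induction k) (simp_all add: dirichlet_character_1[OF assms] dirichlet_character_mult[OF assms])

lemma dirichlet_character_root_of_unity:
  assumes "dirichlet_character q chi" "q > 0" "coprime n (int q)"
  shows "chi n ^ totient q = 1"
proof -
  define m where "m = nat (n mod int q)"
  have m: "int m = n mod int q" using assms(2) by (simp add: m_def)
  have "coprime (int m) (int q)" unfolding m using assms by (simp add: coprime_commute)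
  hence "coprime m q" by simp
  hence "[m ^ totient q = 1] (mod q)" by (rule euler_theorem)
  hence "[int m ^ totient q = 1] (mod int q)"
    using cong_int_iff[of "m ^ totient q" 1 q] by simp
  moreover have "[n ^ totient q = int m ^ totient q] (mod int q)"
    by (intro cong_pow) (simp add: m)
  ultimately have "[n ^ totient q = 1] (mod int q)" using cong_trans by blast
  from dirichlet_character_cong[OF assms(1) this] show ?thesis
    by (simp add: dirichlet_character_power[OF assms(1)] dirichlet_character_1[OF assms(1)])
qed

lemma norm_dirichlet_character:
  assumes "dirichlet_character q chi" "q > 0"
  shows "norm (chi n) = (if coprime n (int q) then 1 else 0)"
proof (cases "coprime n (int q)")
  case True
  have "norm (chi n) ^ totient q = 1"
    using dirichlet_character_root_of_unity[OF assms True] by (metis norm_one norm_power)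
  moreover have "totient q > 0" using assms by simp
  ultimately have "norm (chi n) = 1" 
    using power_eq_imp_eq_base[of "norm (chi n)" "totient q" 1] by simp
  thus ?thesis using True by simp
qed (simp add: dirichlet_character_eq_0_iff[OF assms(1)])

text \<open>A character is fixed by its values on one period, each of them 0 or a root of unity of
  order dividing \<open>totient q\<close>. Finiteness makes the \<open>Max\<close> in the theorem a
  genuine maximum.\<close>

lemma finite_dirichlet_characters:
  assumes "q > 0"
  shows "finite {chi. dirichlet_character q chi}"
proof -
  let ?Z = "insert 0 {z :: complex. z ^ totient q = 1}"
  let ?r = "\<lambda>chi :: int \<Rightarrow> complex. restrict chi {0..<int q}"
  have "finite ({0..<int q} \<rightarrow>\<^sub>E ?Z)"
    using assms by (intro finite_PiE) (auto intro!: finite_nth_roots)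
  moreover have "?r ` {chi. dirichlet_character q chi} \<subseteq> {0..<int q} \<rightarrow>\<^sub>E ?Z"
    using dirichlet_character_root_of_unity[OF _ assms] dirichlet_character_eq_0_iff by fastforce
  moreover have "inj_on ?r {chi. dirichlet_character q chi}"
  proof (rule inj_onI, rule ext)
    fix chi psi n
    assume h: "chi \<in> {chi. dirichlet_character q chi}" "psi \<in> {chi. dirichlet_character q chi}"
      and eq: "?r chi = ?r psi"
    have "n mod int q \<in> {0..<int q}" using assms by simp
    hence "chi (n mod int q) = psi (n mod int q)" using eq by (metis restrict_apply')
    thus "chi n = psi n"
      using h dirichlet_character_cong[of q chi "n mod int q" n]
        dirichlet_character_cong[of q psi "n mod int q" n] by simp
  qed
  ultimately show ?thesis using finite_imageD finite_subset by blast
qed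

subsection \<open>Additive characters and Gauss sums\<close>

definition additive_char :: "nat \<Rightarrow> int \<Rightarrow> complex" where
  "additive_char q a = cis (2 * pi * (of_int a / of_nat q))"

lemma additive_char_add: "additive_char q (a + b) = additive_char q a * additive_char q b"
  by (simp add: additive_char_def cis_mult add_divide_distrib distrib_left)

lemma norm_additive_char [simp]: "norm (additive_char q a) = 1"
  by (simp add: additive_char_def)

lemma cnj_additive_char: "cnj (additive_char q a) = additive_char q (- a)"
  by (simp add: additive_char_def cis_cnj)

lemma additive_char_mult_of_nat: "additive_char q (a * int n) = additive_char q a ^ n"
  unfolding additive_char_def Complex.DeMoivre by (rule arg_cong[where f = cis]) simp

lemma additive_char_eq_1_iff:
  assumes "q > 0"
  shows "additive_char q a = 1 \<longleftrightarrow> int q dvd a"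
proof
  assume "int q dvd a"
  then obtain k where "a = int q * k" by auto
  thus "additive_char q a = 1" using assms by (simp add: additive_char_def)
next
  assume "additive_char q a = 1"
  hence "cos (2 * pi * (of_int a / of_nat q)) = 1"
    by (simp add: additive_char_def complex_eq_iff)
  then obtain k :: int where "2 * pi * (of_int a / of_nat q) = of_int k * 2 * pi"
    by (auto simp: cos_one_2pi_int)
  hence "(of_int a :: real) = of_int (k * int q)" using assms by (simp add: field_simps)
  hence "a = k * int q" by (simp only: of_int_eq_iff)
  thus "int q dvd a" by simp
qed

lemma additive_char_cong:
  assumes "q > 0" "[a = b] (mod int q)"
  shows "additive_char q a = additive_char q b"
proof -
  obtain k where "b = a + int q * k"
    using assms(2) by (auto simp: cong_iff_lin)
  thus ?thesis using additive_char_eq_1_iff[OF assms(1), of "int q * k"]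
    by (simp add: additive_char_add)
qed

lemma norm_additive_char_minus_1:
  assumes "0 < a" "a < q"
  shows "norm (additive_char q (int a) - 1) = 2 * sin (pi * a / q)"
proof -
  have "norm (additive_char q (int a) - 1) = 2 * \<bar>sin (pi * a / q)\<bar>"
    using dist_exp_i_1[of "2 * pi * (a / q)"]
    by (simp add: additive_char_def cis_conv_exp mult_ac)
  moreover have "sin (pi * a / q) \<ge> 0"
    using assms by (intro sin_ge_zero) (auto simp: field_simps)
  ultimately show ?thesis by simp
qed

lemma sum_additive_char:
  assumes "q > 0"
  shows "(\<Sum>a<q. additive_char q (m * int a)) = (if int q dvd m then of_nat q else 0)"
proof (cases "int q dvd m")
  case True
  hence "additive_char q m = 1" using additive_char_eq_1_iff[OF assms] by simp
  thus ?thesis using True by (simp add: additive_char_mult_of_nat)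
next
  case False
  hence "additive_char q m \<noteq> 1" using additive_char_eq_1_iff[OF assms] by simp
  moreover have "additive_char q m ^ q = 1"
    using additive_char_eq_1_iff[OF assms, of "m * int q"] by (simp add: additive_char_mult_of_nat)
  ultimately show ?thesis using False
    by (simp add: additive_char_mult_of_nat sum_gp_strict)
qed

text \<open>The Fourier transform of \<open>chi\<close> on the residues modulo \<open>q\<close>; the
  classical Gauss sum is the value at \<open>a = 1\<close>.\<close>

definition gauss_sum :: "nat \<Rightarrow> (int \<Rightarrow> complex) \<Rightarrow> int \<Rightarrow> complex" where
  "gauss_sum q chi a = (\<Sum>n<q. chi (int n) * additive_char q (a * int n))"

text \<open>Fourier inversion: after exchanging the sums, orthogonality leaves only the residue
  \<open>n\<close> congruent to \<open>m\<close>.\<close>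

lemma gauss_sum_inversion:
  assumes "dirichlet_character q chi" "q > 0"
  shows "(\<Sum>a<q. gauss_sum q chi (int a) * additive_char q (- int a * m)) = of_nat q * chi m"
proof -
  define r where "r = nat (m mod int q)"
  have r: "int r = m mod int q" "r < q" using assms(2) by (simp_all add: r_def nat_less_iff)
  have "(\<Sum>a<q. gauss_sum q chi (int a) * additive_char q (- int a * m))
      = (\<Sum>a<q. \<Sum>n<q. chi (int n) * additive_char q ((int n - m) * int a))"
    unfolding gauss_sum_def sum_distrib_right
    by (intro sum.cong refl) (simp add: mult.assoc additive_char_add[symmetric] algebra_simps)
  also have "\<dots> = (\<Sum>n<q. \<Sum>a<q. chi (int n) * additive_char q ((int n - m) * int a))"
    by (rule sum.swap)
  also have "\<dots> = (\<Sum>n<q. chi (int n) * (if int q dvd int n - m then of_nat q else 0))"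
    using assms(2) by (simp add: sum_distrib_left[symmetric] sum_additive_char)
  also have "\<dots> = (\<Sum>n<q. if n = r then of_nat q * chi (int r) else 0)"
  proof (intro sum.cong refl)
    fix n assume "n \<in> {..<q}"
    hence "int q dvd int n - m \<longleftrightarrow> n = r"
      using r by (auto simp: mod_eq_dvd_iff[symmetric])
    thus "chi (int n) * (if int q dvd int n - m then of_nat q else 0)
        = (if n = r then of_nat q * chi (int r) else 0)" by simp
  qed
  also have "\<dots> = of_nat q * chi (int r)" using r by simp
  also have "chi (int r) = chi m"
    by (rule dirichlet_character_cong[OF assms(1)]) (simp add: r)
  finally show ?thesis .
qed

lemma sum_reindex_unit:
  fixes f :: "int \<Rightarrow> complex"
  assumes "q > 0" "coprime u (int q)" "\<And>m n. [m = n] (mod int q) \<Longrightarrow> f m = f n"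
  shows "(\<Sum>n<q. f (u * int n)) = (\<Sum>n<q. f (int n))"
proof -
  define g where "g n = nat ((u * int n) mod int q)" for n
  have g: "int (g n) = (u * int n) mod int q" for n using assms by (simp add: g_def)
  have "inj_on g {..<q}"
  proof (rule inj_onI)
    fix m n assume mn: "m \<in> {..<q}" "n \<in> {..<q}" "g m = g n"
    hence "[u * int m = u * int n] (mod int q)" using g[of m] g[of n] by (simp add: cong_def)
    hence "[int m = int n] (mod int q)" using assms(2) by (simp add: cong_mult_lcancel)
    thus "m = n" using mn by (simp add: cong_def)
  qed
  moreover have "g n < q" for n
    using assms(1) by (simp add: g_def nat_less_iff)
  hence "g ` {..<q} \<subseteq> {..<q}" by blast
  ultimately have "bij_betw g {..<q} {..<q}"
    by (simp add: bij_betw_def endo_inj_surj)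
  hence "(\<Sum>n<q. f (int n)) = (\<Sum>n<q. f (int (g n)))"
    by (rule sum.reindex_bij_betw[symmetric])
  also have "\<dots> = (\<Sum>n<q. f (u * int n))"
    by (intro sum.cong refl assms(3)) (simp add: g)
  finally show ?thesis by simp
qed

lemma gauss_sum_unit:
  assumes "dirichlet_character q chi" "q > 0" "coprime u (int q)"
  shows "chi u * gauss_sum q chi (a * u) = gauss_sum q chi a"
proof -
  let ?f = "\<lambda>n. chi n * additive_char q (a * n)"
  have "chi u * gauss_sum q chi (a * u) = (\<Sum>n<q. ?f (u * int n))"
    unfolding gauss_sum_def sum_distrib_left
    by (intro sum.cong refl) (simp add: dirichlet_character_mult[OF assms(1)] mult_ac)
  also have "\<dots> = (\<Sum>n<q. ?f (int n))"
  proof (rule sum_reindex_unit[OF assms(2,3)])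
    fix m n assume mn: "[m = n] (mod int q)"
    hence "[a * m = a * n] (mod int q)" by (rule cong_scalar_left)
    with mn show "?f m = ?f n"
      using dirichlet_character_cong[OF assms(1)] additive_char_cong[OF assms(2)] by metis
  qed
  finally show ?thesis by (simp add: gauss_sum_def)
qed

text \<open>Equivalent to the usual primitivity: it suffices to test the maximal proper divisors of \<open>q\<close>.\<close>

definition primitive_character :: "nat \<Rightarrow> (int \<Rightarrow> complex) \<Rightarrow> bool" where
  "primitive_character q chi \<longleftrightarrow> dirichlet_character q chi \<and>
     (\<forall>p. prime p \<and> p dvd q \<longrightarrow>
        (\<exists>u. coprime u (int q) \<and> [u = 1] (mod int (q div p)) \<and> chi u \<noteq> 1))"

text \<open>For \<open>a\<close> coprime to \<open>q\<close> this is the unit substitution.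
  Otherwise a prime \<open>p\<close> divides both, and primitivity provides a unit \<open>u\<close>
  with \<open>a * u\<close> congruent to \<open>a\<close> but \<open>chi u \<noteq> 1\<close>; the
  substitution shows that the sum is \<open>chi u\<close> times itself, so it vanishes along with
  \<open>chi a\<close>.\<close>

lemma gauss_sum_primitive:
  assumes "primitive_character q chi" "q > 0"
  shows "gauss_sum q chi a = cnj (chi a) * gauss_sum q chi 1"
proof (cases "coprime a (int q)")
  case True
  have chi: "dirichlet_character q chi" using assms(1) by (simp add: primitive_character_def)
  have "cnj (chi a) * chi a = 1"
    using norm_dirichlet_character[OF chi assms(2), of a] True
    by (metis complex_norm_square mult.commute of_real_1 one_power2)
  moreover have "chi a * gauss_sum q chi a = gauss_sum q chi 1"
    using gauss_sum_unit[OF chi assms(2) True, of 1] by simp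
  ultimately show ?thesis by (metis mult.assoc mult_1)
next
  case False
  have chi: "dirichlet_character q chi" using assms(1) by (simp add: primitive_character_def)
  have "\<exists>p::nat. prime p \<and> int p dvd a \<and> p dvd q"
  proof -
    have "nat (gcd a (int q)) \<noteq> 1" using False by (auto simp: coprime_iff_gcd_eq_1)
    then obtain p where p: "prime p" "p dvd nat (gcd a (int q))" using prime_factor_nat by blast
    hence "int p dvd gcd a (int q)" by (metis dvd_nat_abs_iff int_nat_eq int_dvd_int_iff gcd_ge_0_int)
    thus ?thesis using p by auto
  qed
  then obtain p :: nat where p: "prime p" "int p dvd a" "p dvd q" by blast
  obtain u where u: "coprime u (int q)" "[u = 1] (mod int (q div p))" "chi u \<noteq> 1"
    using assms(1) p unfolding primitive_character_def by blast
  have "int p * int (q div p) dvd a * (u - 1)"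
    using p u(2) by (intro mult_dvd_mono) (auto simp: cong_iff_dvd_diff)
  hence "int q dvd a * u - a" using p(3) by (simp add: algebra_simps flip: of_nat_mult)
  hence au: "[a * u = a] (mod int q)" by (simp add: cong_iff_dvd_diff)
  have "gauss_sum q chi (a * u) = gauss_sum q chi a"
    unfolding gauss_sum_def
    by (intro sum.cong refl arg_cong2[where f = "(*)"] additive_char_cong assms cong_scalar_right au)
  hence "chi u * gauss_sum q chi a = gauss_sum q chi a"
    using gauss_sum_unit[OF chi assms(2) u(1), of a] by simp
  hence "gauss_sum q chi a = 0" using u(3) by simp
  thus ?thesis using False dirichlet_character_eq_0_iff[OF chi] by simp
qed

text \<open>Inversion at \<open>m = 1\<close>, with every Gauss sum expressed through the one at 1,
  turns \<open>q\<close> into the squared modulus of that sum.\<close>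

lemma norm_gauss_sum_primitive_le:
  assumes "primitive_character q chi" "q > 0"
  shows "norm (gauss_sum q chi a) \<le> sqrt q"
proof -
  have chi: "dirichlet_character q chi" using assms(1) by (simp add: primitive_character_def)
  let ?t = "gauss_sum q chi 1"
  have "of_nat q = (\<Sum>a<q. gauss_sum q chi (int a) * additive_char q (- int a * 1))"
    using gauss_sum_inversion[OF chi assms(2), of 1] by (simp add: dirichlet_character_1[OF chi])
  also have "\<dots> = (\<Sum>a<q. ?t * cnj (chi (int a) * additive_char q (1 * int a)))"
    by (intro sum.cong refl)
       (simp add: gauss_sum_primitive[OF assms, of "int _"] cnj_additive_char)
  also have "\<dots> = ?t * cnj ?t"
    by (simp add: sum_distrib_left[symmetric] gauss_sum_def)
  finally have "complex_of_real (norm ?t ^ 2) = of_real (real q)"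
    by (simp only: complex_norm_square of_real_of_nat_eq)
  hence "norm ?t = sqrt q"
    by (metis norm_ge_zero of_real_eq_iff real_sqrt_unique)
  moreover have "norm (gauss_sum q chi a) = norm (chi a) * norm ?t"
    by (subst gauss_sum_primitive[OF assms]) (simp add: norm_mult)
  ultimately show ?thesis
    using norm_dirichlet_character[OF chi assms(2), of a] by simp
qed

subsection \<open>The Polya-Vinogradov inequality\<close>

text \<open>Jordan's inequality: the concave sine lies above its chord on
  \<open>[0, pi / 2]\<close>.\<close>

lemma sin_ge_linear:
  assumes "0 \<le> x" "x \<le> pi / 2"
  shows "2 * x / pi \<le> sin x"
proof -
  have "convex_on {0..pi/2} (\<lambda>x. - sin x)"
  proof (rule f''_ge0_imp_convex)
    show "((\<lambda>x. - sin x) has_real_derivative - cos x) (at x)" for x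
      by (auto intro!: derivative_eq_intros)
    show "((\<lambda>x. - cos x) has_real_derivative sin x) (at x)" for x
      by (auto intro!: derivative_eq_intros)
    show "sin x \<ge> 0" if "x \<in> {0..pi/2}" for x
      using that by (intro sin_ge_zero) auto
  qed simp_all
  hence "- sin ((1 - 2 * x / pi) *\<^sub>R 0 + (2 * x / pi) *\<^sub>R (pi / 2))
           \<le> (1 - 2 * x / pi) * (- sin 0) + (2 * x / pi) * (- sin (pi / 2))"
    by (rule convex_onD) (use assms in \<open>auto simp: field_simps\<close>)
  thus ?thesis by simp
qed

lemma harm_le_one_plus_ln:
  assumes "n > 0"
  shows "harm n \<le> 1 + ln (real n)"
  using euler_mascheroni_sequence_decreasing[of 1 n] assms by (simp add: harm_def)

text \<open>Jordan's inequality for the smaller of \<open>a\<close> and \<open>q - a\<close>, since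
  the sine is symmetric about \<open>pi / 2\<close>. Keeping both reciprocals spares a case
  distinction when summing over \<open>a\<close>.\<close>

lemma inverse_sin_le:
  assumes "0 < a" "a < q"
  shows "1 / sin (pi * real a / real q) \<le> real q / 2 * (1 / real a + 1 / real (q - a))"
proof -
  have *: "1 / sin (pi * real b / real q) \<le> real q / 2 * (1 / real b)"
    if "0 < b" "2 * b \<le> q" for b
  proof -
    have "2 * (pi * real b / real q) / pi \<le> sin (pi * real b / real q)"
      using that by (intro sin_ge_linear) (auto simp: field_simps simp flip: of_nat_mult)
    hence "2 * real b / real q \<le> sin (pi * real b / real q)" by simp
    moreover have "2 * real b / real q > 0" using that by simp
    ultimately have "1 / sin (pi * real b / real q) \<le> 1 / (2 * real b / real q)"
      by (intro divide_left_mono mult_pos_pos) auto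
    thus ?thesis by simp
  qed
  have q: "real q > 0" using assms by simp
  show ?thesis
  proof (cases "2 * a \<le> q")
    case True
    have "real q / 2 * (1 / real a) \<le> real q / 2 * (1 / real a + 1 / real (q - a))"
      by (intro mult_left_mono) auto
    with *[of a] True assms show ?thesis by linarith
  next
    case False
    have "pi * real a / real q = pi - pi * real (q - a) / real q"
      using assms q by (simp add: field_simps of_nat_diff)
    hence "sin (pi * real a / real q) = sin (pi * real (q - a) / real q)" by simp
    hence "1 / sin (pi * real a / real q) = 1 / sin (pi * real (q - a) / real q)" by (simp only:)
    also have "\<dots> \<le> real q / 2 * (1 / real (q - a))"
      using False assms by (intro *) auto
    also have "\<dots> \<le> real q / 2 * (1 / real a + 1 / real (q - a))"
      by (intro mult_left_mono) auto
    finally show ?thesis .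
  qed
qed

lemma sum_inverse_sin_le:
  assumes "q > 0"
  shows "(\<Sum>a\<in>{1..<q}. 1 / sin (pi * real a / real q)) \<le> real q * (1 + ln (real q))"
proof -
  have "(\<Sum>a\<in>{1..<q}. 1 / sin (pi * real a / real q))
      \<le> (\<Sum>a\<in>{1..<q}. real q / 2 * (1 / real a + 1 / real (q - a)))"
    by (intro sum_mono inverse_sin_le) auto
  also have "\<dots> = real q / 2 * ((\<Sum>a\<in>{1..<q}. 1 / real a) + (\<Sum>a\<in>{1..<q}. 1 / real (q - a)))"
    by (simp only: sum.distrib[symmetric] sum_distrib_left)
  also have "(\<Sum>a\<in>{1..<q}. 1 / real (q - a)) = (\<Sum>a\<in>{1..<q}. 1 / real a)"
    by (rule sum.reindex_bij_witness[of _ "\<lambda>a. q - a" "\<lambda>a. q - a"]) auto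
  also have "real q / 2 * ((\<Sum>a\<in>{1..<q}. 1 / real a) + (\<Sum>a\<in>{1..<q}. 1 / real a))
      \<le> real q / 2 * (harm q + harm q)"
    unfolding harm_def inverse_eq_divide by (intro mult_left_mono add_mono sum_mono2) auto
  also have "\<dots> = real q * harm q" by simp
  also have "\<dots> \<le> real q * (1 + ln (real q))"
    using assms by (intro mult_left_mono harm_le_one_plus_ln) auto
  finally show ?thesis by simp
qed

text \<open>A geometric sum is at most 2 divided by the distance of its ratio from 1, here a chord
  of length \<open>2 * sin (pi * a / q)\<close>.\<close>

lemma norm_sum_additive_char_le:
  assumes "0 < a" "a < q"
  shows "norm (\<Sum>n=1..N. additive_char q (- int a * int n)) \<le> 1 / sin (pi * real a / real q)"
proof -
  define z where "z = additive_char q (- int a)"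
  have nz: "norm (1 - z) = 2 * sin (pi * real a / real q)"
  proof -
    have "1 - z = - cnj (additive_char q (int a) - 1)"
      by (simp add: z_def cnj_additive_char)
    hence "norm (1 - z) = norm (additive_char q (int a) - 1)"
      by (simp only: norm_minus_cancel complex_mod_cnj)
    thus ?thesis by (simp add: norm_additive_char_minus_1[OF assms])
  qed
  have s: "sin (pi * real a / real q) > 0"
    using assms by (intro sin_gt_zero) (auto simp: field_simps)
  have "(\<Sum>n=1..N. additive_char q (- int a * int n)) = (\<Sum>n=1..N. z ^ n)"
    by (simp only: additive_char_mult_of_nat z_def)
  moreover have "(1 - z) * (\<Sum>n=1..N. z ^ n) = z - z ^ Suc N"
  proof (induction N)
    case (Suc N)
    have "(1 - z) * (\<Sum>n=1..Suc N. z ^ n) = (1 - z) * (\<Sum>n=1..N. z ^ n) + (1 - z) * z ^ Suc N"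
      by (simp add: algebra_simps)
    also have "\<dots> = z - z ^ Suc (Suc N)" by (subst Suc) (simp add: algebra_simps)
    finally show ?case .
  qed simp
  hence "norm (1 - z) * norm (\<Sum>n=1..N. z ^ n) = norm (z - z ^ Suc N)"
    by (metis norm_mult)
  moreover have "norm (z - z ^ Suc N) \<le> 2"
    using norm_triangle_ineq4[of z "z ^ Suc N"] by (simp add: z_def norm_mult norm_power)
  ultimately show ?thesis using s nz by (simp add: field_simps)
qed

text \<open>Fourier inversion replaces \<open>chi\<close> by geometric sums over the frequencies
  \<open>a\<close>. Each Gauss sum costs \<open>sqrt q\<close>, and the reciprocal sines add up to
  at most \<open>q * (1 + ln q)\<close>; dividing by \<open>q\<close> leaves the bound.\<close>

lemma polya_vinogradov_primitive:
  assumes "primitive_character q chi" "q > 1"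
  shows "norm (\<Sum>n=1..N. chi (int n)) \<le> sqrt q * (1 + ln (real q))"
proof -
  have chi: "dirichlet_character q chi" using assms(1) by (simp add: primitive_character_def)
  have q: "q > 0" using assms by simp
  \<comment> \<open>The frequency 0 admits no sine bound; it drops out because
    \<open>chi 0 = 0\<close> when \<open>q > 1\<close>.\<close>
  have "gauss_sum q chi 0 = 0"
    using gauss_sum_primitive[OF assms(1) q, of 0] dirichlet_character_eq_0_iff[OF chi, of 0] assms(2)
    by simp
  have "of_nat q * (\<Sum>n=1..N. chi (int n))
      = (\<Sum>n=1..N. \<Sum>a<q. gauss_sum q chi (int a) * additive_char q (- int a * int n))"
    by (simp only: sum_distrib_left gauss_sum_inversion[OF chi q])
  also have "\<dots> = (\<Sum>a<q. gauss_sum q chi (int a) * (\<Sum>n=1..N. additive_char q (- int a * int n)))"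
    by (subst sum.swap) (simp add: sum_distrib_left)
  also have "\<dots> = (\<Sum>a\<in>{1..<q}. gauss_sum q chi (int a) * (\<Sum>n=1..N. additive_char q (- int a * int n)))"
  proof (rule sum.mono_neutral_right)
    show "\<forall>i\<in>{..<q} - {1..<q}. gauss_sum q chi (int i) *
        (\<Sum>n=1..N. additive_char q (- int i * int n)) = 0"
    proof
      fix i assume "i \<in> {..<q} - {1..<q}"
      hence "i = 0" by auto
      thus "gauss_sum q chi (int i) * (\<Sum>n=1..N. additive_char q (- int i * int n)) = 0"
        using \<open>gauss_sum q chi 0 = 0\<close> by simp
    qed
  qed auto
  finally have "real q * norm (\<Sum>n=1..N. chi (int n))
      = norm (\<Sum>a\<in>{1..<q}. gauss_sum q chi (int a) * (\<Sum>n=1..N. additive_char q (- int a * int n)))"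
    by (metis norm_mult norm_of_nat)
  also have "\<dots> \<le> (\<Sum>a\<in>{1..<q}. sqrt q * (1 / sin (pi * real a / real q)))"
    by (intro sum_norm_le order_trans[OF norm_mult_ineq] mult_mono norm_gauss_sum_primitive_le
         assms q norm_sum_additive_char_le) auto
  also have "\<dots> \<le> sqrt q * (real q * (1 + ln (real q)))"
    unfolding sum_distrib_left[symmetric] using q by (intro mult_left_mono sum_inverse_sin_le) auto
  finally have "real q * norm (\<Sum>n=1..N. chi (int n)) \<le> real q * (sqrt q * (1 + ln (real q)))"
    by (simp add: mult_ac)
  thus ?thesis using q by simp
qed

subsection \<open>Descent to primitive characters\<close>

text \<open>Multiply by an inverse \<open>v\<close> of \<open>n\<close> modulo \<open>q\<close>:
  both \<open>m * v\<close> and \<open>n * v\<close> are 1 modulo \<open>d\<close>, and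
  \<open>chi v\<close> can be cancelled.\<close>

lemma imprimitive_character_cong:
  assumes chi: "dirichlet_character q chi" and d: "d dvd q"
    and triv: "\<And>u. coprime u (int q) \<Longrightarrow> [u = 1] (mod int d) \<Longrightarrow> chi u = 1"
    and mn: "coprime m (int q)" "coprime n (int q)" "[m = n] (mod int d)"
  shows "chi m = chi n"
proof -
  obtain v where v: "[n * v = 1] (mod int q)"
    using cong_solve_coprime_int[OF mn(2)] by blast
  have cv: "coprime v (int q)"
    using v by (metis coprime_iff_invertible_int mult.commute)
  have "[n * v = 1] (mod int d)"
    using v d by (meson cong_dvd_modulus int_dvd_int_iff)
  hence "[m * v = 1] (mod int d)"
    using cong_scalar_right[OF mn(3), of v] cong_trans by blast
  hence "chi (m * v) = 1" using mn cv by (intro triv) auto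
  moreover have "chi (n * v) = 1"
    using dirichlet_character_cong[OF chi v] dirichlet_character_1[OF chi] by simp
  ultimately have "chi m * chi v = chi n * chi v"
    by (simp add: dirichlet_character_mult[OF chi])
  moreover have "chi v \<noteq> 0" using cv dirichlet_character_eq_0_iff[OF chi] by blast
  ultimately show ?thesis by simp
qed

text \<open>When the primitivity test fails at \<open>p\<close>, \<open>chi\<close> comes from a
  character modulo \<open>d\<close>, obtained by evaluating \<open>chi\<close> at a representative
  of the class modulo \<open>d\<close> that avoids the multiples of \<open>p\<close>.\<close>

lemma imprimitive_character_induced:
  assumes chi: "dirichlet_character q chi" and p: "prime p" "q = p * d"
    and triv: "\<And>u. coprime u (int q) \<Longrightarrow> [u = 1] (mod int d) \<Longrightarrow> chi u = 1"
  obtains psi where "dirichlet_character d psi"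
    "\<And>n. chi n = (if int p dvd n then 0 else psi n)"
proof -
  \<comment> \<open>If \<open>p\<close> does not divide \<open>d\<close>, adding \<open>d\<close>
    moves a multiple of \<open>p\<close> off the multiples of \<open>p\<close> without changing its
    class modulo \<open>d\<close>; if \<open>p\<close> divides \<open>d\<close>, no unit modulo
    \<open>d\<close> is a multiple of \<open>p\<close>.\<close>
  define r where "r n = (if int p dvd n \<and> \<not> p dvd d then n + int d else n)" for n
  have r_cong: "[r n = n] (mod int d)" for n by (simp add: r_def cong_def)
  have cop_p: "coprime n (int p) \<longleftrightarrow> \<not> int p dvd n" for n
    using p(1) by (metis coprime_commute prime_imp_coprime prime_nat_int_transfer
        not_prime_unit coprime_absorb_left)
  have cop_q: "coprime n (int q) \<longleftrightarrow> \<not> int p dvd n \<and> coprime n (int d)" for n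
    using p(2) by (simp add: cop_p)
  have r_cop: "coprime (r n) (int q) \<longleftrightarrow> coprime n (int d)" for n
  proof -
    have "coprime (r n) (int d) \<longleftrightarrow> coprime n (int d)"
      using cong_gcd_eq[OF r_cong[of n]] by (simp add: coprime_iff_gcd_eq_1)
    moreover have "\<not> int p dvd r n" if "coprime n (int d)"
    proof (cases "p dvd d")
      case True
      hence "\<not> int p dvd n"
        using that p(1) by (metis coprime_common_divisor int_dvd_int_iff not_prime_unit prime_nat_int_transfer)
      thus ?thesis using True by (simp add: r_def)
    next
      case False
      thus ?thesis by (auto simp: r_def dvd_add_right_iff)
    qed
    ultimately show ?thesis using cop_q by blast
  qed
  have d: "d dvd q" using p by simp
  define psi where "psi n = chi (r n)" for n
  have psi0: "psi n = 0 \<longleftrightarrow> \<not> coprime n (int d)" for n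
    by (simp add: psi_def dirichlet_character_eq_0_iff[OF chi] r_cop)
  have "dirichlet_character d psi"
    unfolding dirichlet_character_def
  proof (intro conjI allI)
    show "psi (n + int d) = psi n" for n
    proof (cases "coprime n (int d)")
      case True
      have "coprime (n + int d) (int d)"
        using True gcd_add1[of n "int d"] by (simp only: coprime_iff_gcd_eq_1)
      moreover have "[r (n + int d) = r n] (mod int d)"
        using r_cong[of "n + int d"] r_cong[of n] by (simp add: cong_def)
      ultimately show ?thesis unfolding psi_def using True
        by (intro imprimitive_character_cong[OF chi d triv]) (auto simp: r_cop)
    next
      case False
      hence "\<not> coprime (n + int d) (int d)"
        using gcd_add1[of n "int d"] by (simp only: coprime_iff_gcd_eq_1 not_False_eq_True)
      with False show ?thesis using psi0[of n] psi0[of "n + int d"] by simp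
    qed
    show "psi (m * n) = psi m * psi n" for m n
    proof (cases "coprime (m * n) (int d)")
      case True
      have "[r (m * n) = r m * r n] (mod int d)"
        using r_cong[of "m * n"] cong_mult[OF r_cong[of m] r_cong[of n]]
        by (simp add: cong_def)
      hence "chi (r (m * n)) = chi (r m * r n)" using True
        by (intro imprimitive_character_cong[OF chi d triv]) (auto simp: r_cop)
      thus ?thesis by (simp add: psi_def dirichlet_character_mult[OF chi])
    next
      case False
      thus ?thesis using psi0[of "m * n"] psi0[of m] psi0[of n] by auto
    qed
    show "(psi n \<noteq> 0) = coprime n (int d)" for n using psi0 by blast
  qed
  moreover have "chi n = (if int p dvd n then 0 else psi n)" for n
    using dirichlet_character_eq_0_iff[OF chi, of n] cop_q[of n] by (auto simp: psi_def r_def)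
  ultimately show ?thesis using that by blast
qed

lemma sum_coprime_prime_split:
  fixes psi :: "int \<Rightarrow> complex"
  assumes psi: "dirichlet_character d psi" and p: "prime p"
  shows "(\<Sum>n=1..N. if int p dvd int n then 0 else psi (int n))
       = (\<Sum>n=1..N. psi (int n)) - psi (int p) * (\<Sum>n=1..N div p. psi (int n))"
proof -
  have p0: "p > 0" using p prime_gt_0_nat by blast
  have "psi (int p) * (\<Sum>n=1..N div p. psi (int n)) = (\<Sum>n=1..N div p. psi (int (p * n)))"
    by (simp add: sum_distrib_left dirichlet_character_mult[OF psi])
  also have "\<dots> = (\<Sum>n | n \<in> {1..N} \<and> p dvd n. psi (int n))"
  proof (rule sum.reindex_bij_witness[of _ "\<lambda>n. n div p" "\<lambda>n. p * n"], goal_cases)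
    case (1 a) thus ?case using p0 by simp
  next
    case (2 a) thus ?case using p0 by (auto simp: less_eq_div_iff_mult_less_eq mult.commute)
  next
    case (3 b) thus ?case by simp
  next
    case (4 b) thus ?case using p0 by (auto simp: div_le_mono dest: dvd_imp_le intro!: Suc_leI div_greater_zero_iff[THEN iffD2])
  qed simp
  also have "\<dots> = (\<Sum>n=1..N. if int p dvd int n then psi (int n) else 0)"
    by (subst sum.inter_filter[symmetric]) (simp_all cong: conj_cong)
  finally show ?thesis
    by (simp add: sum_subtractf[symmetric]) (intro sum.cong, auto)
qed

text \<open>Passing from modulus \<open>q div p\<close> to \<open>q\<close> may double the character sum. The factor \<open>sqrt p\<close> gained
  in \<open>sqrt q\<close> absorbs this for \<open>p \<ge> 5\<close>; the weights at 2 and 3 account for the two exceptions.\<close>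

definition pv_bound :: "nat \<Rightarrow> real" where
  "pv_bound q = (if 2 dvd q then 2 else 1) * (if 3 dvd q then 2 else 1) * (sqrt q * (1 + ln (real q)))"

lemma pv_bound_mono:
  assumes "d dvd q" "q > 0"
  shows "pv_bound d \<le> pv_bound q"
proof -
  have "d \<le> q" "d > 0" using assms by (auto intro: dvd_imp_le dvd_pos_nat)
  thus ?thesis unfolding pv_bound_def using assms(1)
    by (intro mult_mono) (auto intro: dvd_trans)
qed

lemma pv_bound_double:
  assumes "prime p" "\<not> p dvd d" "d > 0"
  shows "2 * pv_bound d \<le> pv_bound (p * d)"
proof -
  define W :: "nat \<Rightarrow> real" where "W q = (if 2 dvd q then 2 else 1) * (if 3 dvd q then 2 else 1)" for q
  define G :: "nat \<Rightarrow> real" where "G q = sqrt q * (1 + ln (real q))" for q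
  have pv: "pv_bound q = W q * G q" for q by (simp add: pv_bound_def W_def G_def)
  have p: "p \<ge> 2" using assms prime_ge_2_nat by blast
  have G0: "G d \<ge> 0" using assms by (simp add: G_def)
  have W0: "W d \<ge> 0" by (simp add: W_def)
  have ln: "1 + ln (real d) \<le> 1 + ln (real (p * d))" using assms p by simp
  have Gp: "sqrt p * G d \<le> G (p * d)"
    unfolding G_def using assms ln
    by (simp add: real_sqrt_mult mult_left_mono mult.assoc)
  show ?thesis
  proof (cases "p = 2 \<or> p = 3")
    case True
    \<comment> \<open>As \<open>p\<close> does not divide \<open>d\<close>, its weight is absent
      from \<open>W d\<close> and present in \<open>W (p * d)\<close>, while the other weight is
      unchanged.\<close>
    have "W (p * d) = 2 * W d"
      using True assms by (auto simp: W_def prime_dvd_mult_iff coprime_dvd_mult_right_iff)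
    moreover have "1 * G d \<le> sqrt p * G d" using p G0 by (intro mult_right_mono) auto
    hence "G d \<le> G (p * d)" using Gp by linarith
    ultimately show ?thesis using W0 by (simp add: pv mult_left_mono)
  next
    case False
    have "p \<noteq> 4" using assms(1) by (auto simp: prime_nat_iff dest: spec[of _ 2])
    hence "p \<ge> 4" using False p by auto
    hence "sqrt 4 \<le> sqrt p" by (simp only: real_sqrt_le_iff)
    hence "2 * G d \<le> sqrt p * G d" using G0 by (intro mult_right_mono) auto
    hence "2 * G d \<le> G (p * d)" using Gp by linarith
    moreover have "W d \<le> W (p * d)" by (auto simp: W_def)
    ultimately have "W d * (2 * G d) \<le> W (p * d) * G (p * d)"
      using G0 W0 by (intro mult_mono) (auto simp: W_def)
    thus ?thesis by (simp add: pv mult_ac)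
  qed
qed

text \<open>Strong induction on the modulus. An imprimitive \<open>chi\<close> is induced from
  \<open>q div p\<close>; deleting the multiples of \<open>p\<close> either changes nothing
  (\<open>psi p = 0\<close>) or brings in a second sum of \<open>psi\<close>, and
  \<open>pv_bound\<close> is designed to absorb this doubling.\<close>

lemma polya_vinogradov_pv_bound:
  assumes "chi \<in> nonprincipal_characters q" "q > 0"
  shows "norm (\<Sum>n=1..N. chi (int n)) \<le> pv_bound q"
  using assms
proof (induction q arbitrary: chi N rule: less_induct)
  case (less q)
  have chi: "dirichlet_character q chi" and np: "chi \<noteq> principal_character q"
    using less.prems by (auto simp: nonprincipal_characters_def)
  have "q \<noteq> 1"
  proof
    assume "q = 1"
    hence "chi n = 1" for n
      using dirichlet_character_cong[OF chi, of n 1] dirichlet_character_1[OF chi] by simp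
    thus False using np \<open>q = 1\<close> by (auto simp: principal_character_def)
  qed
  hence q1: "q > 1" using less.prems by simp
  show ?case
  proof (cases "primitive_character q chi")
    case True
    have "1 * (sqrt q * (1 + ln (real q))) \<le> pv_bound q"
      unfolding pv_bound_def using q1 by (intro mult_right_mono) auto
    thus ?thesis using polya_vinogradov_primitive[OF True q1, of N] by simp
  next
    case False
    then obtain p where p: "prime p" "p dvd q"
      and triv: "\<And>u. coprime u (int q) \<Longrightarrow> [u = 1] (mod int (q div p)) \<Longrightarrow> chi u = 1"
      using chi unfolding primitive_character_def by blast
    define d where "d = q div p"
    have q: "q = p * d" using p by (simp add: d_def)
    have d: "0 < d" "d < q" using q less.prems p(1) prime_gt_1_nat[of p] by auto
    obtain psi where psi: "dirichlet_character d psi"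
      "\<And>n. chi n = (if int p dvd n then 0 else psi n)"
      using imprimitive_character_induced[OF chi p(1) q triv[folded d_def]] by blast
    have "psi \<noteq> principal_character d"
    proof
      assume *: "psi = principal_character d"
      have "chi n = principal_character q n" for n
        using psi(2)[of n] dirichlet_character_eq_0_iff[OF chi, of n]
        by (auto simp: * principal_character_def q split: if_splits)
      with np show False by blast
    qed
    hence IH: "norm (\<Sum>n=1..M. psi (int n)) \<le> pv_bound d" for M
      using less.IH[OF d(2) _ d(1)] psi(1) by (simp add: nonprincipal_characters_def)
    have eq: "(\<Sum>n=1..N. chi (int n))
        = (\<Sum>n=1..N. psi (int n)) - psi (int p) * (\<Sum>n=1..N div p. psi (int n))"
      using sum_coprime_prime_split[OF psi(1) p(1), of N] by (simp only: psi(2))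
    show ?thesis
    proof (cases "p dvd d")
      case True
      hence "psi (int p) = 0"
        using dirichlet_character_eq_0_iff[OF psi(1), of "int p"] p(1)
        by (auto simp: coprime_absorb_left dest: prime_gt_1_nat)
      hence "norm (\<Sum>n=1..N. chi (int n)) \<le> pv_bound d" using eq IH by simp
      also have "\<dots> \<le> pv_bound q" using q less.prems by (intro pv_bound_mono) auto
      finally show ?thesis .
    next
      case False
      have "norm (psi (int p)) \<le> 1" using norm_dirichlet_character[OF psi(1) d(1)] by simp
      hence "norm (psi (int p) * (\<Sum>n=1..N div p. psi (int n))) \<le> 1 * pv_bound d"
        unfolding norm_mult by (intro mult_mono IH) auto
      hence "norm (\<Sum>n=1..N. chi (int n)) \<le> 2 * pv_bound d"
        unfolding eq by (intro order_trans[OF norm_triangle_ineq4]) (use IH[of N] in simp)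
      also have "\<dots> \<le> pv_bound q" unfolding q by (intro pv_bound_double p False d)
      finally show ?thesis .
    qed
  qed
qed

theorem polya_vinogradov:
  assumes "chi \<in> nonprincipal_characters q" "q > 0"
  shows "norm (\<Sum>n=1..N. chi (int n)) \<le> 4 * sqrt q * (1 + ln (real q))"
proof -
  have "pv_bound q \<le> 4 * (sqrt q * (1 + ln (real q)))"
    unfolding pv_bound_def using assms(2) by (intro mult_right_mono) auto
  thus ?thesis using polya_vinogradov_pv_bound[OF assms, of N] by simp
qed

subsection \<open>Harmonic sums over integers free of given primes\<close>

text \<open>Stated for every positive \<open>x\<close>, including \<open>x < 1\<close> where the sum
  is empty, because sieving evaluates the sum at \<open>x\<close> divided by primes and may go below
  1.\<close>

lemma harm_approx:
  fixes x :: real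
  assumes "x > 0"
  shows "\<bar>harm (nat \<lfloor>x\<rfloor>) - (ln x + euler_mascheroni)\<bar> \<le> 2 / x"
proof (cases "x < 1")
  case True
  hence "nat \<lfloor>x\<rfloor> = 0" by (simp add: floor_le_zero)
  moreover have "- ln x \<le> 1 / x - 1"
    using ln_le_minus_one[of "1 / x"] assms by (simp add: ln_div)
  moreover have "ln x \<le> 0" using True assms by simp
  moreover have "(euler_mascheroni :: real) < 13/22" by (rule euler_mascheroni_less_13_over_22)
  moreover have "(euler_mascheroni :: real) > 0" by (rule euler_mascheroni_pos)
  moreover have "1 / x \<ge> 1" using True assms by simp
  moreover have "2 / x = 2 * (1 / x)" by simp
  ultimately show ?thesis by (simp add: harm_def abs_le_iff)
next
  case False
  define n where "n = nat \<lfloor>x\<rfloor>"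
  have n: "n \<ge> 1" "real n \<le> x" "x < real n + 1"
    using False unfolding n_def by linarith+
  have "harm n \<ge> euler_mascheroni + ln (real (Suc n)) - 1 / (2 * real n)"
       "harm n \<le> euler_mascheroni + ln (real (Suc n))"
    using euler_mascheroni_bounds[of n] n
    by (auto simp: inverse_eq_divide) (smt (verit) divide_nonneg_nonneg of_nat_0_le_iff)
  moreover have "ln (real n) \<le> ln x" "ln x \<le> ln (real (Suc n))" using n by auto
  moreover have "ln (real (Suc n)) - ln (real n) \<le> 1 / real n"
    using ln_diff_le[of "real (Suc n)" "real n"] n by simp
  moreover have "1 / (2 * real n) \<le> 1 / real n" using n by (simp add: field_simps)
  moreover have "1 / real n \<le> 2 / x" using n by (simp add: field_simps)
  ultimately show ?thesis unfolding n_def[symmetric] by (simp add: abs_le_iff)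
qed

text \<open>For the prime factors of \<open>q\<close> this is Euler's product for
  \<open>totient q / q\<close>.\<close>

definition prime_prod :: "nat set \<Rightarrow> real" where
  "prime_prod P = (\<Prod>p\<in>P. 1 - 1 / real p)"

definition prime_log_sum :: "nat set \<Rightarrow> real" where
  "prime_log_sum P = (\<Sum>p\<in>P. ln (real p) / (real p - 1))"

definition sifted :: "nat set \<Rightarrow> real \<Rightarrow> nat set" where
  "sifted P x = {n. 0 < n \<and> real n \<le> x \<and> (\<forall>p\<in>P. \<not> p dvd n)}"

lemma finite_sifted [simp]: "finite (sifted P x)"
proof (rule finite_subset)
  show "sifted P x \<subseteq> {..nat \<lfloor>x\<rfloor>}" by (auto simp: sifted_def le_nat_floor)
qed simp

text \<open>Sieving by one more prime removes the \<open>n = p * m\<close> with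
  \<open>m \<le> x / p\<close>; here \<open>m\<close> is free of \<open>P\<close> exactly when
  \<open>p * m\<close> is, because \<open>p\<close> is a prime outside \<open>P\<close>.\<close>

lemma sum_sifted_insert:
  assumes P: "\<And>r. r \<in> P \<Longrightarrow> prime r" and p: "prime p" "p \<notin> P"
  shows "(\<Sum>n\<in>sifted (insert p P) x. 1 / real n)
       = (\<Sum>n\<in>sifted P x. 1 / real n) - (\<Sum>n\<in>sifted P (x / real p). 1 / real n) / real p"
proof -
  have p0: "p > 0" using p prime_gt_0_nat by blast
  have "(\<Sum>n\<in>sifted P (x / real p). 1 / real n) / real p
      = (\<Sum>n\<in>sifted P (x / real p). 1 / real (p * n))"
    by (simp add: sum_divide_distrib mult.commute)
  also have "\<dots> = (\<Sum>n\<in>{n \<in> sifted P x. p dvd n}. 1 / real n)"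
  proof (rule sum.reindex_bij_witness[of _ "\<lambda>n. n div p" "\<lambda>n. p * n"], goal_cases)
    case (2 n)
    have "\<not> r dvd p * n" if "r \<in> P" for r
      using that P[OF that] p 2 primes_dvd_imp_eq[of r p]
      by (auto simp: sifted_def prime_dvd_mult_iff)
    with 2 p0 show ?case by (auto simp: sifted_def field_simps)
  next
    case (4 n)
    then obtain k where "n = p * k" by auto
    with 4 p0 show ?case by (auto simp: sifted_def field_simps)
  qed (use p0 in auto)
  finally have "(\<Sum>n\<in>sifted P (x / real p). 1 / real n) / real p
      = (\<Sum>n\<in>{n \<in> sifted P x. p dvd n}. 1 / real n)" .
  moreover have "sifted (insert p P) x = sifted P x - {n \<in> sifted P x. p dvd n}"
    by (auto simp: sifted_def)
  ultimately show ?thesis by (simp add: sum_diff)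
qed

text \<open>The main term satisfies the recursion of the sieved sum. The error at
  \<open>x / p\<close>, divided by \<open>p\<close>, has the same bound as the one at
  \<open>x\<close>, so every prime doubles the error bound.\<close>

lemma sum_sifted_approx:
  assumes "finite P" "\<And>p. p \<in> P \<Longrightarrow> prime p" "x > 0"
  shows "\<bar>(\<Sum>n\<in>sifted P x. 1 / real n)
            - prime_prod P * (ln x + euler_mascheroni + prime_log_sum P)\<bar> \<le> 2 ^ card P * (2 / x)"
  using assms
proof (induction P arbitrary: x rule: finite_induct)
  case empty
  have "sifted {} x = {1..nat \<lfloor>x\<rfloor>}"
    using empty by (auto simp: sifted_def le_nat_iff le_floor_iff Suc_le_eq)
  thus ?case using harm_approx[OF empty(2)]
    by (simp add: harm_def inverse_eq_divide prime_prod_def prime_log_sum_def)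
next
  case (insert p P)
  let ?A = "\<lambda>P x. \<Sum>n\<in>sifted P x. 1 / real n"
  let ?M = "\<lambda>P x. prime_prod P * (ln x + euler_mascheroni + prime_log_sum P)"
  let ?s = "prime_log_sum P"
  have p: "prime p" "real p > 1" using insert.prems prime_gt_1_nat[of p] by auto
  have P: "\<And>r. r \<in> P \<Longrightarrow> prime r" using insert.prems by auto
  have xp: "x / real p > 0" using insert.prems p by simp
  \<comment> \<open>\<open>ln (x / p)\<close> contributes an extra \<open>ln p / p\<close>, which is
    \<open>(1 - 1 / p) * (ln p / (p - 1))\<close>.\<close>
  have "?M P x - ?M P (x / real p) / real p
      = prime_prod P * (1 - 1 / real p) * (ln x + euler_mascheroni + ?s + ln (real p) / (real p - 1))"
    using p insert.prems by (simp add: ln_div divide_simps) (simp add: algebra_simps)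
  also have "\<dots> = ?M (insert p P) x"
    using insert.hyps by (simp add: prime_prod_def prime_log_sum_def mult_ac add_ac)
  finally have M: "?M (insert p P) x = ?M P x - ?M P (x / real p) / real p" by simp
  have A: "?A (insert p P) x = ?A P x - ?A P (x / real p) / real p"
    by (rule sum_sifted_insert) (use P p insert.hyps in auto)
  have "?A (insert p P) x - ?M (insert p P) x
      = (?A P x - ?M P x) - (?A P (x / real p) - ?M P (x / real p)) / real p"
    unfolding M A by (simp add: diff_divide_distrib)
  also have "\<bar>\<dots>\<bar> \<le> \<bar>?A P x - ?M P x\<bar> + \<bar>?A P (x / real p) - ?M P (x / real p)\<bar> / real p"
    using p by (intro order_trans[OF abs_triangle_ineq4]) (simp add: abs_divide)
  also have "\<dots> \<le> 2 ^ card P * (2 / x) + 2 ^ card P * (2 / (x / real p)) / real p"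
    using p by (intro add_mono divide_right_mono insert.IH P insert.prems xp) auto
  also have "\<dots> = 2 ^ card (insert p P) * (2 / x)"
    using p insert.hyps by simp
  finally show ?case .
qed

text \<open>Primes are added in increasing order: the \<open>k\<close>-th one is at least
  \<open>k + 1\<close>, so the product dominates the telescoping product of the factors
  \<open>1 - 1 / (k + 1)\<close>.\<close>

lemma prime_prod_ge:
  assumes "finite P" "\<And>p. p \<in> P \<Longrightarrow> prime p"
  shows "prime_prod P \<ge> 1 / (real (card P) + 1)"
  using assms
proof (induction P rule: finite_linorder_max_induct)
  case (insert b A)
  have "A \<subseteq> {2..<b}" using insert prime_ge_2_nat by auto
  hence "card A \<le> b - 2" using card_mono[of "{2..<b}" A] by simp
  moreover have "b \<ge> 2" using insert prime_ge_2_nat by auto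
  ultimately have b: "real b \<ge> real (card A) + 2" by linarith
  have "b \<notin> A" using insert by auto
  have "1 / (real (card (insert b A)) + 1)
      = (1 - 1 / (real (card A) + 2)) * (1 / (real (card A) + 1))"
    using insert.hyps \<open>b \<notin> A\<close> by (simp add: divide_simps) (simp add: algebra_simps)
  also have "\<dots> \<le> (1 - 1 / real b) * prime_prod A"
    using b insert by (intro mult_mono diff_left_mono divide_left_mono) auto
  also have "\<dots> = prime_prod (insert b A)"
    using insert \<open>b \<notin> A\<close> by (simp add: prime_prod_def)
  finally show ?case .
qed (simp add: prime_prod_def)

section \<open>The number of distinct prime factors\<close>

lemma prod_primes_dvd:
  fixes n :: nat
  assumes "finite P" "\<And>p. p \<in> P \<Longrightarrow> prime p \<and> p dvd n"
  shows "\<Prod>P dvd n"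
  using assms
proof (induction P rule: finite_induct)
  case (insert p P)
  have "coprime p (\<Prod>P)"
    using insert by (intro prod_coprime_right primes_coprime) auto
  thus ?case using insert by (simp add: divides_mult)
qed simp

text \<open>A prime above 3 pays for its own factor 4; the primes 2 and 3 are each granted an
  additional factor 2, which gives the constant 4.\<close>

lemma four_power_card_primes_le:
  fixes P :: "nat set"
  assumes "finite P" "\<And>p. p \<in> P \<Longrightarrow> prime p"
  shows "4 ^ card P \<le> 4 * \<Prod>P"
proof -
  have "4 ^ card P \<le> (if 2 \<in> P then 2 else 1) * (if 3 \<in> P then 2 else 1) * \<Prod>P"
    using assms
  proof (induction P rule: finite_induct)
    case (insert p P)
    have "p = 2 \<or> p = 3 \<or> p \<ge> 4"
      using insert.prems[of p] prime_ge_2_nat[of p] by auto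
    thus ?case
    proof (elim disjE)
      assume "p \<ge> 4"
      have "4 ^ card (insert p P) = 4 * 4 ^ card P" using insert.hyps by simp
      also have "\<dots> \<le> p * ((if 2 \<in> P then 2 else 1) * (if 3 \<in> P then 2 else 1) * \<Prod>P)"
        using \<open>p \<ge> 4\<close> insert by (intro mult_mono) auto
      also have "\<dots> = (if 2 \<in> insert p P then 2 else 1) * (if 3 \<in> insert p P then 2 else 1) * \<Prod>(insert p P)"
        using \<open>p \<ge> 4\<close> insert.hyps by simp
      finally show ?thesis .
    qed (use insert in auto)
  qed simp
  also have "\<dots> \<le> 4 * \<Prod>P" by (intro mult_right_mono) auto
  finally show ?thesis .
qed

text \<open>The sieving error carries \<open>2 ^ card (prime_factors q)\<close>; this bound lets a
  cut slightly above \<open>sqrt q\<close> control it.\<close>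

lemma two_power_card_prime_factors_le:
  assumes "q > 0"
  shows "2 ^ card (prime_factors q) \<le> 2 * sqrt (real q)"
proof -
  have "\<Prod>(prime_factors q) dvd q"
    by (rule prod_primes_dvd) auto
  hence "\<Prod>(prime_factors q) \<le> q" using assms by (simp add: dvd_imp_le)
  hence "4 ^ card (prime_factors q) \<le> 4 * q"
    using four_power_card_primes_le[of "prime_factors q"] by fastforce
  hence "real (4 ^ card (prime_factors q)) \<le> real (4 * q)" by (simp only: of_nat_le_iff)
  moreover have "(4::real) ^ k = (2 ^ k)\<^sup>2" for k
    by (simp add: power_mult[symmetric] mult.commute[of _ 2]) (simp add: power_mult)
  ultimately have "(2 ^ card (prime_factors q))\<^sup>2 \<le> (2 * sqrt (real q))\<^sup>2"
    by (simp add: power_mult_distrib)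
  thus ?thesis by (rule power2_le_imp_le) simp
qed

section \<open>Chebyshev-type estimates for sums of \<open>ln p\<close>\<close>

lemma sum_ln_primes_le:
  fixes n :: nat
  assumes "finite P" "\<And>p. p \<in> P \<Longrightarrow> prime p \<and> p dvd n" "n > 0"
  shows "(\<Sum>p\<in>P. ln (real p)) \<le> ln (real n)"
proof -
  have pos: "p > 0" if "p \<in> P" for p using assms(2)[OF that] prime_gt_0_nat by blast
  have "(\<Sum>p\<in>P. ln (real p)) = ln (real (\<Prod>P))"
    using pos assms(1) by (simp add: ln_prod)
  also have "\<dots> \<le> ln (real n)"
    using prod_primes_dvd[OF assms(1,2)] assms(3) pos
    by (intro ln_mono) (auto simp: dvd_imp_le prod_pos simp flip: of_nat_prod)
  finally show ?thesis .
qed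

text \<open>A prime in \<open>(n, 2n]\<close> divides the central binomial coefficient, which is at most \<open>4^n\<close>.\<close>

lemma sum_ln_over_primes_dyadic:
  assumes "n > 0"
  shows "(\<Sum>p | prime p \<and> n < p \<and> p \<le> 2 * n. ln (real p) / real p) \<le> 2 * ln 2"
proof -
  let ?P = "{p. prime p \<and> n < p \<and> p \<le> 2 * n}"
  have fin: "finite ?P" by (rule finite_subset[of _ "{..2*n}"]) auto
  have "p dvd (2 * n) choose n" if "p \<in> ?P" for p
  proof -
    have "fact n * fact n * ((2 * n) choose n) = fact (2 * n)"
      using binomial_fact_lemma[of n "2 * n"] by simp
    moreover have "p dvd fact (2 * n)" "\<not> p dvd fact n"
      using that by (auto simp: prime_dvd_fact_iff)
    ultimately show ?thesis using that by (metis (no_types, lifting) mem_Collect_eq prime_dvd_mult_iff)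
  qed
  hence "(\<Sum>p\<in>?P. ln (real p)) \<le> ln (real ((2 * n) choose n))"
    by (intro sum_ln_primes_le fin) auto
  also have "\<dots> \<le> ln (2 ^ (2 * n))"
  proof (rule ln_mono)
    have "real ((2 * n) choose n) \<le> real (2 ^ (2 * n))"
      using binomial_le_pow2[of "2 * n" n] by (simp only: of_nat_le_iff)
    thus "real ((2 * n) choose n) \<le> 2 ^ (2 * n)" by simp
  qed auto
  also have "\<dots> = 2 * real n * ln 2" by (simp add: ln_realpow)
  finally have *: "(\<Sum>p\<in>?P. ln (real p)) \<le> 2 * real n * ln 2" .
  have "(\<Sum>p\<in>?P. ln (real p) / real p) \<le> (\<Sum>p\<in>?P. ln (real p) / real n)"
    using assms by (intro sum_mono divide_left_mono) auto
  also have "\<dots> = (\<Sum>p\<in>?P. ln (real p)) / real n" by (simp add: sum_divide_distrib)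
  also have "\<dots> \<le> 2 * real n * ln 2 / real n" using * by (intro divide_right_mono) auto
  also have "\<dots> = 2 * ln 2" using assms by simp
  finally show ?thesis .
qed

lemma sum_ln_over_primes_power_two:
  "(\<Sum>p | prime p \<and> p \<le> 2 ^ k. ln (real p) / real p) \<le> real k * (2 * ln 2)"
proof (induction k)
  case 0
  have "{p::nat. prime p \<and> p \<le> 2 ^ 0} = {}" by (auto dest: prime_gt_1_nat)
  thus ?case by (simp only: sum.empty)
next
  case (Suc k)
  have "{p::nat. prime p \<and> p \<le> 2 ^ Suc k}
      = {p. prime p \<and> p \<le> 2 ^ k} \<union> {p. prime p \<and> 2 ^ k < p \<and> p \<le> 2 * 2 ^ k}"
    by auto
  hence "(\<Sum>p | prime p \<and> p \<le> 2 ^ Suc k. ln (real p) / real p)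
      = (\<Sum>p | prime p \<and> p \<le> 2 ^ k. ln (real p) / real p)
        + (\<Sum>p | prime p \<and> 2 ^ k < p \<and> p \<le> 2 * 2 ^ k. ln (real p) / real p)"
    by (simp only:) (rule sum.union_disjoint,
        auto intro: finite_subset[of _ "{..2 * 2 ^ k}"])
  also have "\<dots> \<le> real k * (2 * ln 2) + 2 * ln 2"
    by (intro add_mono Suc sum_ln_over_primes_dyadic) auto
  finally show ?case by (simp add: algebra_simps)
qed

lemma prime_log_sum_le:
  fixes y :: real
  assumes "y \<ge> 1"
  shows "prime_log_sum {p. prime p \<and> real p \<le> y} \<le> 4 * ln y + 4 * ln 2"
proof -
  define k where "k = nat \<lceil>log 2 y\<rceil>"
  have k: "log 2 y \<le> real k" "real k \<le> log 2 y + 1"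
    using assms zero_le_log_cancel_iff[of 2 y] unfolding k_def by linarith+
  have "y = 2 powr log 2 y" using assms by simp
  also have "\<dots> \<le> 2 powr real k" using k by (intro powr_mono) auto
  finally have yk: "y \<le> 2 ^ k" by (simp add: powr_realpow)
  have "p \<le> 2 ^ k" if "real p \<le> y" for p
  proof -
    have "real p \<le> real (2 ^ k)" using that yk by (simp only: of_nat_power of_nat_numeral)
    thus ?thesis by (simp only: of_nat_le_iff)
  qed
  hence sub: "{p. prime p \<and> real p \<le> y} \<subseteq> {p. prime p \<and> p \<le> 2 ^ k}" by auto
  have fin: "finite {p::nat. prime p \<and> p \<le> 2 ^ k}"
    by (rule finite_subset[of _ "{..2^k}"]) auto
  have "prime_log_sum {p. prime p \<and> real p \<le> y}
      \<le> (\<Sum>p | prime p \<and> real p \<le> y. 2 * (ln (real p) / real p))"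
    unfolding prime_log_sum_def
  proof (rule sum_mono)
    fix p assume "p \<in> {p. prime p \<and> real p \<le> y}"
    hence "real p \<ge> 2" using prime_ge_2_nat[of p] by simp
    hence "ln (real p) / (real p - 1) \<le> ln (real p) / (real p / 2)"
      by (intro divide_left_mono) auto
    thus "ln (real p) / (real p - 1) \<le> 2 * (ln (real p) / real p)" by (simp add: mult.commute)
  qed
  also have "\<dots> \<le> (\<Sum>p | prime p \<and> p \<le> 2 ^ k. 2 * (ln (real p) / real p))"
    using sub fin by (intro sum_mono2) (auto dest!: prime_gt_0_nat)
  also have "\<dots> \<le> 2 * (real k * (2 * ln 2))"
    unfolding sum_distrib_left[symmetric] using sum_ln_over_primes_power_two[of k] by simp
  also have "\<dots> \<le> 2 * ((log 2 y + 1) * (2 * ln 2))"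
    using k by (intro mult_left_mono mult_right_mono) auto
  also have "\<dots> = 4 * ln y + 4 * ln 2" by (simp add: log_def field_simps)
  finally show ?thesis .
qed

lemma ln_3_gt_1: "ln (3::real) > 1"
proof -
  have "2 \<le> 3 * ln (2::real)" using ln2_ge_two_thirds by simp
  also have "3 * ln (2::real) = ln (2 ^ 3)" by (subst ln_realpow) auto
  also have "\<dots> < ln (3 ^ 2 :: real)" by simp
  also have "\<dots> = 2 * ln 3" by (subst ln_realpow) auto
  finally show ?thesis by simp
qed

lemma ln_gt_1:
  assumes "q \<ge> 3"
  shows "ln (real q) > 1"
  by (rule less_le_trans[OF ln_3_gt_1]) (use assms in simp)

text \<open>Split the prime factors at \<open>ln q\<close>. The small ones are among all primes up
  to \<open>ln q\<close>; for the large ones the denominators are at least \<open>ln q / 2\<close>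
  while the numerators sum to at most \<open>ln q\<close>.\<close>

lemma prime_log_sum_prime_factors_le:
  assumes "q \<ge> 3"
  shows "prime_log_sum (prime_factors q) \<le> 4 * ln (ln (real q)) + 5"
proof -
  define y where "y = ln (real q)"
  have y: "y \<ge> 1" using ln_gt_1[OF assms] by (simp add: y_def)
  have fin: "finite {p. prime p \<and> real p \<le> y}"
    by (rule finite_subset[of _ "{..nat \<lfloor>y\<rfloor>}"]) (auto simp: le_nat_floor)
  let ?S = "{p \<in> prime_factors q. real p \<le> y}" and ?L = "{p \<in> prime_factors q. real p > y}"
  have "prime_factors q = ?S \<union> ?L" by auto
  hence "prime_log_sum (prime_factors q) = prime_log_sum ?S + prime_log_sum ?L"
    unfolding prime_log_sum_def by (subst (1) \<open>prime_factors q = ?S \<union> ?L\<close>, subst sum.union_disjoint) auto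
  moreover have "prime_log_sum ?S \<le> prime_log_sum {p. prime p \<and> real p \<le> y}"
    unfolding prime_log_sum_def using fin by (intro sum_mono2) (auto dest!: prime_gt_0_nat)
  moreover have "prime_log_sum ?L \<le> 2"
  proof -
    have "prime_log_sum ?L \<le> (\<Sum>p\<in>?L. 2 / y * ln (real p))"
      unfolding prime_log_sum_def
    proof (rule sum_mono)
      fix p assume p: "p \<in> ?L"
      hence "prime p" by auto
      hence "real p \<ge> 2" using prime_ge_2_nat[of p] by simp
      moreover from this have "y / 2 \<le> real p - 1" using p by auto
      ultimately have "ln (real p) / (real p - 1) \<le> ln (real p) / (y / 2)"
        using y by (intro divide_left_mono) auto
      thus "ln (real p) / (real p - 1) \<le> 2 / y * ln (real p)" by (simp add: mult.commute)
    qed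
    also have "\<dots> = 2 / y * (\<Sum>p\<in>?L. ln (real p))" by (simp add: sum_distrib_left)
    also have "\<dots> \<le> 2 / y * y"
      unfolding y_def[symmetric] using y assms
      by (intro mult_left_mono order_trans[OF sum_ln_primes_le[of _ q]]) (auto simp: y_def)
    finally show ?thesis using y by simp
  qed
  moreover have "4 * ln 2 \<le> (3::real)"
    using ln2_le_25_over_36 by simp
  ultimately show ?thesis using prime_log_sum_le[OF y] by (simp add: y_def)
qed

subsection \<open>A lower bound of Mertens type for the Euler product\<close>

text \<open>A finite one-sided Euler product, free of convergence questions. A number built from
  \<open>insert p P\<close> is either built from \<open>P\<close> or is \<open>p\<close> times a
  smaller number of the same kind, so the new sum is at most the old one plus \<open>g p\<close>
  times itself.\<close>

lemma sum_smooth_le_euler_product: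
  fixes g :: "nat \<Rightarrow> real"
  assumes "finite P" "\<And>p. p \<in> P \<Longrightarrow> prime p"
    and g1: "g 1 = 1" and g_mult: "\<And>m n. g (m * n) = g m * g n"
    and g_nonneg: "\<And>n. g n \<ge> 0" and g_less: "\<And>p. prime p \<Longrightarrow> g p < 1"
  shows "(\<Sum>n | 0 < n \<and> n \<le> N \<and> (\<forall>p. prime p \<and> p dvd n \<longrightarrow> p \<in> P). g n)
           \<le> (\<Prod>p\<in>P. 1 / (1 - g p))"
  using assms(1,2)
proof (induction P rule: finite_induct)
  case empty
  have "{n. 0 < n \<and> n \<le> N \<and> (\<forall>p. prime p \<and> p dvd n \<longrightarrow> p \<in> {})} \<subseteq> {1}"
    using prime_factor_nat by auto
  hence "(\<Sum>n | 0 < n \<and> n \<le> N \<and> (\<forall>p. prime p \<and> p dvd n \<longrightarrow> p \<in> {}). g n) \<le> (\<Sum>n\<in>{1}. g n)"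
    by (intro sum_mono2 g_nonneg) auto
  thus ?case by (simp only: g1 sum.insert_if sum.empty prod.empty finite.emptyI) simp
next
  case (insert p P)
  define S where "S Q = {n. 0 < n \<and> n \<le> N \<and> (\<forall>p. prime p \<and> p dvd n \<longrightarrow> p \<in> Q)}" for Q
  have fin: "finite (S Q)" for Q
    by (rule finite_subset[of _ "{..N}"]) (auto simp: S_def)
  have p: "prime p" using insert.prems by simp
  hence p0: "p > 0" using prime_gt_0_nat by blast
  have sub: "S (insert p P) \<subseteq> S P \<union> (\<lambda>n. p * n) ` S (insert p P)"
  proof
    fix n assume n: "n \<in> S (insert p P)"
    show "n \<in> S P \<union> (\<lambda>n. p * n) ` S (insert p P)"
    proof (cases "p dvd n")
      case True
      then obtain m where m: "n = p * m" by auto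
      have "m \<le> n" using m p0 by simp
      hence "m \<le> N" using n by (simp add: S_def)
      hence "m \<in> S (insert p P)" using n m by (auto simp: S_def)
      thus ?thesis using m by blast
    next
      case False
      thus ?thesis using n by (auto simp: S_def)
    qed
  qed
  have "sum g (S (insert p P)) \<le> sum g (S P \<union> (\<lambda>n. p * n) ` S (insert p P))"
    using sub fin by (intro sum_mono2 g_nonneg) auto
  also have "\<dots> \<le> sum g (S P) + sum g ((\<lambda>n. p * n) ` S (insert p P))"
    using fin by (subst sum_Un) (auto intro!: sum_nonneg g_nonneg)
  also have "sum g ((\<lambda>n. p * n) ` S (insert p P)) = g p * sum g (S (insert p P))"
    using p0 by (subst sum.reindex) (auto simp: inj_on_def g_mult sum_distrib_left)
  finally have "(1 - g p) * sum g (S (insert p P)) \<le> sum g (S P)" by (simp add: algebra_simps)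
  also have "\<dots> \<le> (\<Prod>p\<in>P. 1 / (1 - g p))" using insert by (simp add: S_def)
  finally show ?case using insert.hyps g_less[OF p] by (simp add: S_def field_simps)
qed

text \<open>Comparison with the integral of \<open>t powr (- (1 + e))\<close>, done term by term
  through the mean value theorem. As \<open>N\<close> grows it expresses
  \<open>zeta(1 + e) \<ge> 1 / e\<close>.\<close>

lemma sum_powr_ge:
  fixes e :: real
  assumes "e > 0"
  shows "(1 - real (Suc N) powr (- e)) / e \<le> (\<Sum>n=1..N. real n powr (- (1 + e)))"
proof (induction N)
  case (Suc N)
  define a where "a = real (Suc N)"
  have a: "a > 0" by (simp add: a_def)
  have "\<exists>z>a. z < a + 1 \<and> (a + 1) powr (-e) - a powr (-e) = (a + 1 - a) * (- e * z powr (- e - 1))"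
    using a by (intro MVT2) (auto intro!: derivative_eq_intros)
  then obtain z where z: "z > a" "(a + 1) powr (-e) - a powr (-e) = - e * z powr (- e - 1)" by auto
  have "z powr (- e - 1) \<le> a powr (- e - 1)"
    using z a assms by (intro powr_mono2') auto
  hence "e * z powr (- e - 1) \<le> e * a powr (- e - 1)" using assms by simp
  moreover have "- (1 + e) = - e - 1" by simp
  ultimately have "a powr (-e) - (a + 1) powr (-e) \<le> e * a powr (- (1 + e))"
    using z(2) by (simp only:)
  hence "(a powr (-e) - (a + 1) powr (-e)) / e \<le> a powr (- (1 + e))"
    using assms by (simp add: field_simps)
  moreover have "(1 - real (Suc (Suc N)) powr (- e)) / e
      = (1 - a powr (- e)) / e + (a powr (-e) - (a + 1) powr (-e)) / e"
    by (simp add: a_def add_divide_distrib[symmetric] add_ac)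
  ultimately show ?case using Suc by (simp add: a_def)
qed (use assms in simp)

text \<open>Concavity of \<open>ln\<close> between \<open>1 - t\<close> and 1. With
  \<open>a = p powr (- e)\<close> and \<open>t = 1 / p\<close> it compares the Euler factor at
  \<open>1 + e\<close> with the weighted one at 1.\<close>

lemma ln_one_minus_mult_ge:
  fixes a t :: real
  assumes "0 \<le> a" "a \<le> 1" "0 \<le> t" "t < 1"
  shows "a * ln (1 - t) \<le> ln (1 - a * t)"
proof -
  have "a * ln (1 - t) + (1 - a) * ln 1 \<le> ln (a *\<^sub>R (1 - t) + (1 - a) *\<^sub>R 1)"
    using assms by (intro ln_concave[unfolded concave_on_iff, THEN conjunct2, rule_format]) auto
  also have "a *\<^sub>R (1 - t) + (1 - a) *\<^sub>R 1 = 1 - a * t" by (simp add: algebra_simps)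
  finally show ?thesis by simp
qed

definition primes_upto :: "real \<Rightarrow> nat set" where
  "primes_upto x = {p. prime p \<and> real p \<le> x}"

lemma finite_primes_upto [simp]: "finite (primes_upto x)"
  by (rule finite_subset[of _ "{..nat \<lfloor>x\<rfloor>}"]) (auto simp: primes_upto_def le_nat_floor)

lemma prime_primes_upto: "p \<in> primes_upto x \<Longrightarrow> prime p"
  by (simp add: primes_upto_def)

text \<open>Every \<open>n\<close> from 1 to \<open>N\<close> has only prime factors up to
  \<open>N\<close>, so the Euler product over these primes dominates the partial sum of
  \<open>zeta(1 + e)\<close>. Taking logarithms and using concavity yields the weights
  \<open>p powr (- e)\<close>.\<close>

lemma sum_ln_euler_factor_ge:
  fixes e :: real
  assumes "e > 0" "N > 0"
  shows "ln ((1 - real (Suc N) powr (- e)) / e)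
           \<le> (\<Sum>p\<in>primes_upto (real N). - ln (1 - 1 / real p) * real p powr (- e))"
proof -
  define g where "g n = real n powr (- (1 + e))" for n :: nat
  have g1: "g p < 1" if "prime p" for p
  proof -
    have "real p > 1" using prime_gt_1_nat[OF that] by simp
    hence "real p powr (- (1 + e)) < real p powr 0" using assms by (intro powr_less_mono) auto
    thus ?thesis using \<open>real p > 1\<close> by (simp add: g_def)
  qed
  have pos: "(1 - real (Suc N) powr (- e)) / e > 0"
  proof -
    have "real (Suc N) powr (- e) < real (Suc N) powr 0"
      using assms by (intro powr_less_mono) auto
    thus ?thesis using assms by simp
  qed
  have "(1 - real (Suc N) powr (- e)) / e \<le> (\<Sum>n=1..N. g n)"
    unfolding g_def by (rule sum_powr_ge[OF assms(1)])
  also have "\<dots> = (\<Sum>n | 0 < n \<and> n \<le> N \<and> (\<forall>p. prime p \<and> p dvd n \<longrightarrow> p \<in> primes_upto (real N)). g n)"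
  proof (rule sum.cong)
    show "{1..N} = {n. 0 < n \<and> n \<le> N \<and> (\<forall>p. prime p \<and> p dvd n \<longrightarrow> p \<in> primes_upto (real N))}"
      by (auto simp: primes_upto_def dest: dvd_imp_le)
  qed simp
  also have "\<dots> \<le> (\<Prod>p\<in>primes_upto (real N). 1 / (1 - g p))"
    by (rule sum_smooth_le_euler_product)
       (auto simp: prime_primes_upto g1, auto simp: g_def powr_mult)
  finally have "ln ((1 - real (Suc N) powr (- e)) / e) \<le> ln (\<Prod>p\<in>primes_upto (real N). 1 / (1 - g p))"
    using pos by (intro ln_mono) auto
  also have "\<dots> = (\<Sum>p\<in>primes_upto (real N). ln (1 / (1 - g p)))"
    by (rule ln_prod) (auto dest!: prime_primes_upto g1)
  also have "\<dots> \<le> (\<Sum>p\<in>primes_upto (real N). - ln (1 - 1 / real p) * real p powr (- e))"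
  proof (rule sum_mono)
    fix p assume "p \<in> primes_upto (real N)"
    hence p: "prime p" "real p > 1" using prime_primes_upto prime_gt_1_nat by force+
    have "real p powr (- e) \<le> real p powr 0" using p assms by (intro powr_mono) auto
    hence "real p powr (- e) * ln (1 - 1 / real p) \<le> ln (1 - real p powr (- e) * (1 / real p))"
      using p by (intro ln_one_minus_mult_ge) auto
    also have "real p powr (- e) * (1 / real p) = g p"
      using p powr_add[of "real p" "- e" "- 1"] by (simp add: g_def powr_minus_divide add.commute)
    finally show "ln (1 / (1 - g p)) \<le> - ln (1 - 1 / real p) * real p powr (- e)"
      using g1[OF p(1)] by (simp add: ln_div mult.commute)
  qed
  finally show ?thesis .
qed

lemma ln_le_powr_minus_one_div:
  fixes t d :: real
  assumes "t > 0" "d > 0"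
  shows "ln t \<le> (t powr d - 1) / d"
  using ln_le_minus_one[of "t powr d"] assms by (simp add: field_simps ln_powr)

text \<open>Uses \<open>p powr (- e) = \<integral>t\<ge>e * ln p. exp (- t)\<close>. Replacing \<open>ln t\<close> by \<open>(t powr d - 1) / d\<close> avoids the integral of
  \<open>ln t * exp (- t)\<close>; the last summand accounts for the range \<open>t < e * u0\<close>, where \<open>bound\<close> is not available.\<close>

lemma sum_weighted_primes_le:
  fixes c e d u0 :: real and N :: nat
  assumes c: "c \<ge> 1" and e: "0 < e" "e < 1" and d: "d > 0" and u0: "u0 > 0"
    and bound: "\<And>u. u \<ge> u0 \<Longrightarrow> (\<Sum>p\<in>primes_upto (exp u). - ln (1 - 1 / real p)) \<le> ln u + ln c"
  shows "(\<Sum>p\<in>primes_upto (real N). - ln (1 - 1 / real p) * real p powr (- e))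
           \<le> ln c - ln e + (Gamma (1 + d) - 1) / d
              + ((\<Sum>p\<in>primes_upto (exp u0). - ln (1 - 1 / real p)) + 1 / d) * (1 - exp (- (e * u0)))"
proof -
  define f where "f p = - ln (1 - 1 / real p)" for p :: nat
  \<comment> \<open>The summand \<open>1 / d\<close> compensates for \<open>a\<close>, which is only
    known to be at least \<open>- (1 / d)\<close>.\<close>
  define K where "K = (\<Sum>p\<in>primes_upto (exp u0). f p) + 1 / d"
  define a where "a = ln c - ln e - 1 / d"
  \<comment> \<open>\<open>F\<close> integrates to the weighted prime sum and \<open>G\<close> is an
    integrable majorant of \<open>F\<close>; the bracket after \<open>K\<close> is
    \<open>exp (- t)\<close> restricted to \<open>t < e * u0\<close>.\<close>
  define G where "G t = a * exp (- t) + (1 / d) * (t powr d / exp t)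
      + K * (exp (- t) - (if t \<in> {e * u0..} then exp (- t) else 0))" for t :: real
  define F where "F t = (\<Sum>p\<in>primes_upto (real N). f p * (if t \<in> {e * ln (real p)..} then exp (- t) else 0))"
    for t :: real
  have p1: "real p > 1" if "p \<in> primes_upto x" for p x
    using that prime_gt_1_nat[of p] by (simp add: primes_upto_def)
  have f0: "f p \<ge> 0" if "p \<in> primes_upto x" for p x
    using p1[OF that] by (simp add: f_def)
  have E: "((\<lambda>t. exp (- t)) has_integral exp (- b)) {b..}" for b :: real
    using has_integral_exp_minus_to_infinity[of 1 b] by simp
  have EI: "((\<lambda>t. if t \<in> {b..} then exp (- t) else 0) has_integral exp (- b)) {0..}" if "b \<ge> 0" for b :: real
    using E[of b] that by (subst has_integral_restrict) auto
  have "(F has_integral (\<Sum>p\<in>primes_upto (real N). f p * exp (- (e * ln (real p))))) {0..}"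
    unfolding F_def
    by (intro has_integral_sum has_integral_mult_right EI) (use e p1 in \<open>auto intro!: mult_nonneg_nonneg dest!: p1\<close>)
  moreover have "(G has_integral (a * exp (- 0) + (1 / d) * Gamma (1 + d) + K * (exp (- 0) - exp (- (e * u0))))) {0..}"
    unfolding G_def
    using Gamma_integral_real[of "1 + d"] d e u0
    by (intro has_integral_add has_integral_diff has_integral_mult_right E EI) auto
  moreover have "F t \<le> G t" if "t \<in> {0..}" for t
  proof -
    define S where "S = (\<Sum>p\<in>primes_upto (exp (t / e)). f p)"
    have "F t = exp (- t) * (\<Sum>p\<in>{p \<in> primes_upto (real N). e * ln (real p) \<le> t}. f p)"
      unfolding F_def sum_distrib_left by (subst sum.inter_filter) (auto intro!: sum.cong)
    also have "\<dots> \<le> exp (- t) * S"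
    proof -
      have "{p \<in> primes_upto (real N). e * ln (real p) \<le> t} \<subseteq> primes_upto (exp (t / e))"
      proof
        fix p assume p: "p \<in> {p \<in> primes_upto (real N). e * ln (real p) \<le> t}"
        hence "real p > 1" using p1 by blast
        moreover have "ln (real p) \<le> t / e" using p e by (simp add: field_simps)
        ultimately have "real p \<le> exp (t / e)" using exp_le_cancel_iff[of "ln (real p)" "t / e"] by simp
        thus "p \<in> primes_upto (exp (t / e))" using p by (simp add: primes_upto_def)
      qed
      thus ?thesis unfolding S_def using f0 by (intro mult_left_mono sum_mono2) auto
    qed
    also have "exp (- t) * S \<le> G t"
    proof (cases "t \<ge> e * u0")
      case True
      hence t: "t > 0" "t / e \<ge> u0" using e u0 by (auto simp: field_simps intro: less_le_trans[rotated])
      have "S \<le> ln (t / e) + ln c" using bound[OF t(2)] by (simp add: S_def f_def)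
      also have "\<dots> = ln t + (ln c - ln e)" using t e by (simp add: ln_div)
      also have "\<dots> \<le> (t powr d - 1) / d + (ln c - ln e)"
        using ln_le_powr_minus_one_div[OF t(1) d] by simp
      also have "\<dots> = a + t powr d / d" by (simp add: a_def diff_divide_distrib)
      finally have "exp (- t) * S \<le> exp (- t) * (a + t powr d / d)" by simp
      thus ?thesis using True by (simp add: G_def exp_minus field_simps)
    next
      case False
      have "primes_upto (exp (t / e)) \<subseteq> primes_upto (exp u0)"
      proof -
        have "exp (t / e) \<le> exp u0" using False e by (simp add: field_simps)
        thus ?thesis unfolding primes_upto_def using order_trans by blast
      qed
      hence "S \<le> K - 1 / d" unfolding S_def K_def using f0 by (auto intro!: sum_mono2)
      \<comment> \<open>This is where \<open>c \<ge> 1\<close> and \<open>e < 1\<close>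
        enter.\<close>
      moreover have "a \<ge> - (1 / d)"
      proof -
        have "ln c \<ge> 0" "ln e \<le> 0" using c e by auto
        thus ?thesis by (simp add: a_def)
      qed
      moreover have "t powr d / d \<ge> 0" using d by simp
      ultimately have "S \<le> a + t powr d / d + K" by linarith
      hence "exp (- t) * S \<le> exp (- t) * (a + t powr d / d + K)" by simp
      thus ?thesis using False by (simp add: G_def exp_minus field_simps)
    qed
    finally show ?thesis .
  qed
  ultimately have "(\<Sum>p\<in>primes_upto (real N). f p * exp (- (e * ln (real p))))
      \<le> a * exp (- 0) + (1 / d) * Gamma (1 + d) + K * (exp (- 0) - exp (- (e * u0)))"
    by (rule has_integral_le)
  moreover have "(\<Sum>p\<in>primes_upto (real N). f p * exp (- (e * ln (real p))))
      = (\<Sum>p\<in>primes_upto (real N). f p * real p powr (- e))"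
    using p1 by (intro sum.cong refl) (force simp: powr_def)
  ultimately show ?thesis by (simp add: f_def K_def a_def diff_divide_distrib)
qed

text \<open>The lower and upper bounds for the same weighted prime sum are compared in three limits:
  \<open>N\<close> to infinity, then \<open>e\<close> to 0, then \<open>d\<close> to 0.\<close>

lemma euler_mascheroni_le_of_mertens_bound:
  fixes c u0 :: real
  assumes c: "c \<ge> 1" and u0: "u0 > 0"
    and bound: "\<And>u. u \<ge> u0 \<Longrightarrow> (\<Sum>p\<in>primes_upto (exp u). - ln (1 - 1 / real p)) \<le> ln u + ln c"
  shows "euler_mascheroni \<le> ln c"
proof -
  define K where "K d = (\<Sum>p\<in>primes_upto (exp u0). - ln (1 - 1 / real p)) + 1 / d" for d
  \<comment> \<open>The limit in \<open>N\<close>: the lower bound tends to \<open>- ln e\<close>,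
    which cancels against the same term of the upper bound.\<close>
  have 1: "0 \<le> ln c + (Gamma (1 + d) - 1) / d + K d * (1 - exp (- (e * u0)))"
    if e: "0 < e" "e < 1" and d: "d > 0" for d e :: real
  proof -
    have "(\<lambda>N. ln ((1 - real (Suc N) powr (- e)) / e)) \<longlonglongrightarrow> ln ((1 - 0) / e)"
      using e by (intro tendsto_intros LIMSEQ_Suc[OF tendsto_neg_powr[OF _ filterlim_real_sequentially]]) auto
    moreover have "\<forall>\<^sub>F N in sequentially. ln ((1 - real (Suc N) powr (- e)) / e)
        \<le> ln c - ln e + (Gamma (1 + d) - 1) / d + K d * (1 - exp (- (e * u0)))"
      using eventually_gt_at_top[of 0]
    proof eventually_elim
      case (elim N)
      show ?case unfolding K_def
        by (rule order_trans[OF sum_ln_euler_factor_ge[OF e(1) elim]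
              sum_weighted_primes_le[OF c e d u0 bound]])
    qed
    ultimately have "ln ((1 - 0) / e) \<le> ln c - ln e + (Gamma (1 + d) - 1) / d + K d * (1 - exp (- (e * u0)))"
      by (intro tendsto_upperbound) auto
    thus ?thesis using e by (simp add: ln_div)
  qed
  \<comment> \<open>Letting \<open>e\<close> tend to 0 with \<open>d\<close> fixed removes the term
    with \<open>K d\<close>.\<close>
  have 2: "0 \<le> ln c + (Gamma (1 + d) - 1) / d" if d: "d > 0" for d :: real
  proof -
    have "((\<lambda>e. ln c + (Gamma (1 + d) - 1) / d + K d * (1 - exp (- (e * u0)))) \<longlongrightarrow>
            ln c + (Gamma (1 + d) - 1) / d + K d * (1 - exp (- (0 * u0)))) (at_right 0)"
      by (intro tendsto_intros)
    moreover have "\<forall>\<^sub>F e in at_right 0. 0 \<le> ln c + (Gamma (1 + d) - 1) / d + K d * (1 - exp (- (e * u0)))"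
      using eventually_at_right_real[of 0 1] by (auto elim!: eventually_mono intro!: 1 d)
    ultimately show ?thesis by (auto dest!: tendsto_lowerbound)
  qed
  \<comment> \<open>\<open>(Gamma (1 + d) - 1) / d\<close> is a difference quotient whose limit is
    \<open>Digamma 1\<close>, that is \<open>- euler_mascheroni\<close>.\<close>
  have "(Gamma has_real_derivative (Gamma 1 * Digamma 1)) (at 1)"
    by (rule has_field_derivative_Gamma) (auto simp: nonpos_Ints_def)
  hence "((\<lambda>d. (Gamma (1 + d) - Gamma 1) / d) \<longlongrightarrow> - euler_mascheroni) (at (0::real))"
    by (simp add: DERIV_def)
  hence "((\<lambda>d. (Gamma (1 + d) - 1) / d) \<longlongrightarrow> - euler_mascheroni) (at_right (0::real))"
    by (simp add: filterlim_at_split)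
  hence "((\<lambda>d. ln c + (Gamma (1 + d) - 1) / d) \<longlongrightarrow> ln c + - euler_mascheroni) (at_right (0::real))"
    by (intro tendsto_intros)
  moreover have "\<forall>\<^sub>F d in at_right 0. 0 \<le> ln c + (Gamma (1 + d) - 1) / (d::real)"
    using eventually_at_right_less[of "0::real"] by eventually_elim (use 2 in auto)
  ultimately have "0 \<le> ln c + - (euler_mascheroni :: real)"
    by (auto dest!: tendsto_lowerbound)
  thus ?thesis by simp
qed

text \<open>Were it false, the reverse inequality for all \<open>n \<ge> N\<close> would, after
  taking logarithms, be the hypothesis of \<open>euler_mascheroni_le_of_mertens_bound\<close> with a
  constant below \<open>exp euler_mascheroni\<close>.\<close>

lemma frequently_euler_product_gt:
  fixes c :: real
  assumes "c < exp euler_mascheroni"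
  shows "\<exists>n\<ge>N. c * ln (real n) * prime_prod (primes_upto (real n)) < 1"
proof (rule ccontr)
  assume neg: "\<not> ?thesis"
  \<comment> \<open>The maximum secures \<open>c' \<ge> 1\<close>, and it stays below
    \<open>exp euler_mascheroni\<close> since that exceeds 1.\<close>
  define c' where "c' = max 1 c"
  have c': "c' \<ge> 1" "c' \<ge> c" "c' < exp euler_mascheroni"
    using assms euler_mascheroni_pos by (auto simp: c'_def)
  \<comment> \<open>From this point on, \<open>nat \<lfloor>exp u\<rfloor>\<close> is at least
    \<open>N\<close> and at least 3, so the negated claim applies and \<open>ln n\<close> is
    positive.\<close>
  define u0 where "u0 = ln (real N + 3)"
  have u0: "u0 > 0" by (simp add: u0_def)
  have "(\<Sum>p\<in>primes_upto (exp u). - ln (1 - 1 / real p)) \<le> ln u + ln c'" if u: "u \<ge> u0" for u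
  proof -
    define n where "n = nat \<lfloor>exp u\<rfloor>"
    have "exp u \<ge> exp u0" using u by simp
    hence eu: "exp u \<ge> real N + 3" by (simp add: u0_def)
    hence n: "n \<ge> N" "n \<ge> 3" "real n \<le> exp u" unfolding n_def by linarith+
    have eq: "primes_upto (exp u) = primes_upto (real n)"
    proof -
      have "real p \<le> exp u \<longleftrightarrow> real p \<le> real n" for p
        using n(3) le_nat_floor[of p "exp u"] unfolding n_def[symmetric] by auto
      thus ?thesis by (simp only: primes_upto_def)
    qed
    have pos: "prime_prod (primes_upto (real n)) > 0"
      unfolding prime_prod_def by (intro prod_pos) (auto simp: primes_upto_def dest!: prime_gt_1_nat)
    have ln0: "ln (real n) > 0" using n by simp
    have "1 \<le> c * ln (real n) * prime_prod (primes_upto (real n))" using neg n by force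
    also have "\<dots> \<le> c' * ln (real n) * prime_prod (primes_upto (real n))"
      using c' ln0 pos by (intro mult_right_mono) auto
    finally have "0 \<le> ln (c' * ln (real n) * prime_prod (primes_upto (real n)))" by simp
    also have "\<dots> = ln c' + ln (ln (real n)) + ln (prime_prod (primes_upto (real n)))"
      using c' ln0 pos by (simp add: ln_mult)
    finally have "- ln (prime_prod (primes_upto (real n))) \<le> ln c' + ln (ln (real n))" by simp
    also have "ln (prime_prod (primes_upto (real n))) = (\<Sum>p\<in>primes_upto (real n). ln (1 - 1 / real p))"
      unfolding prime_prod_def
      by (intro ln_prod) (auto simp: primes_upto_def dest!: prime_gt_1_nat)
    also have "ln (ln (real n)) \<le> ln u"
    proof -
      have "ln (real n) \<le> u" using n ln_mono[of "real n" "exp u"] by simp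
      thus ?thesis using ln0 by simp
    qed
    finally show ?thesis by (simp add: eq sum_negf)
  qed
  from euler_mascheroni_le_of_mertens_bound[OF c'(1) u0 this]
  have "exp euler_mascheroni \<le> c'" using c' by (simp add: ln_ge_iff)
  with c' show False by simp
qed

subsection \<open>The bound for \<open>L(1, \<chi>)\<close>\<close>

text \<open>Abel summation. The boundary term at \<open>M\<close> cancels against the telescoped
  sum, which leaves twice the one at \<open>N\<close>.\<close>

lemma norm_sum_over_n_le:
  fixes a :: "nat \<Rightarrow> complex"
  assumes bound: "\<And>N. norm (\<Sum>n=1..N. a n) \<le> B" and "N \<le> M"
  shows "norm (\<Sum>n=Suc N..M. a n / of_nat n) \<le> 2 * B / real (Suc N)"
proof -
  define S where "S N = (\<Sum>n=1..N. a n)" for N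
  have S: "norm (S n) \<le> B" for n using bound by (simp add: S_def)
  have tel: "(\<Sum>n=Suc N..M. a n / of_nat n) = S M / of_nat (Suc M) - S N / of_nat (Suc N)
      + (\<Sum>n=Suc N..M. S n * of_real (1 / real n - 1 / real (Suc n)))"
    using \<open>N \<le> M\<close>
  proof (induction M rule: dec_induct)
    case (step M)
    have a: "a (Suc M) / of_nat (Suc M) = S (Suc M) / of_nat (Suc M) - S M / of_nat (Suc M)"
      by (simp add: S_def add_divide_distrib)
    have last: "(\<Sum>n=Suc N..Suc M. g n) = (\<Sum>n=Suc N..M. g n) + g (Suc M)" for g :: "nat \<Rightarrow> complex"
      using step.hyps by simp
    show ?case unfolding last step.IH a by (simp add: algebra_simps)
  qed simp
  have tel': "(\<Sum>n=Suc N..M. 1 / real n - 1 / real (Suc n)) = 1 / real (Suc N) - 1 / real (Suc M)"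
    using \<open>N \<le> M\<close> by (induction M rule: dec_induct) auto
  have "norm (\<Sum>n=Suc N..M. S n * of_real (1 / real n - 1 / real (Suc n)))
      \<le> (\<Sum>n=Suc N..M. B * (1 / real n - 1 / real (Suc n)))"
  proof (rule sum_norm_le)
    fix n assume "n \<in> {Suc N..M}"
    hence "1 / real n - 1 / real (Suc n) \<ge> 0" by (auto simp: field_simps)
    thus "norm (S n * of_real (1 / real n - 1 / real (Suc n))) \<le> B * (1 / real n - 1 / real (Suc n))"
      unfolding norm_mult norm_of_real using S[of n] by (simp add: mult_right_mono)
  qed
  also have "\<dots> = B / real (Suc N) - B / real (Suc M)"
    unfolding sum_distrib_left[symmetric] tel' by (simp add: right_diff_distrib)
  finally have 1: "norm (\<Sum>n=Suc N..M. S n * of_real (1 / real n - 1 / real (Suc n)))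
      \<le> B / real (Suc N) - B / real (Suc M)" .
  have 2: "norm (S n / of_nat (Suc n)) \<le> B / real (Suc n)" for n
    unfolding norm_divide norm_of_nat using S by (intro divide_right_mono) auto
  have "norm (S M / of_nat (Suc M) - S N / of_nat (Suc N)) \<le> B / real (Suc M) + B / real (Suc N)"
    by (rule order_trans[OF norm_triangle_ineq4]) (intro add_mono 2)
  hence "norm (\<Sum>n=Suc N..M. a n / of_nat n)
      \<le> (B / real (Suc M) + B / real (Suc N)) + (B / real (Suc N) - B / real (Suc M))"
    unfolding tel using 1 by (intro order_trans[OF norm_triangle_ineq] add_mono)
  thus ?thesis by simp
qed

text \<open>The tail bound from Abel summation serves twice: it proves convergence, which gives
  \<open>suminf\<close> its meaning, and it bounds what lies beyond an arbitrary cut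
  \<open>N\<close>.\<close>

lemma norm_Dirichlet_L_1_le:
  assumes bound: "\<And>N. norm (\<Sum>n=1..N. chi (int n)) \<le> B"
  shows "norm (Dirichlet_L 1 chi) \<le> (\<Sum>n=1..N. norm (chi (int n)) / real n) + 2 * B / real (Suc N)"
proof -
  define f where "f n = chi (int (Suc n)) * of_nat (Suc n) powr (- 1)" for n
  have f: "f n = chi (int (Suc n)) / of_nat (Suc n)" for n
    by (simp add: f_def powr_minus divide_inverse)
  \<comment> \<open>Index 0 of the series holds the term for \<open>n = 1\<close>, so
    \<open>{m..<n}\<close> becomes \<open>{Suc m..n}\<close>.\<close>
  have sum_f: "sum f {m..<n} = (\<Sum>k=Suc m..n. chi (int k) / of_nat k)" for m n
    by (rule sum.reindex_bij_witness[of _ "\<lambda>k. k - 1" Suc]) (auto simp: f)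
  have tail: "norm (sum f {m..<n}) \<le> 2 * B / real (Suc m)" for m n
  proof (cases "m \<le> n")
    case True
    thus ?thesis unfolding sum_f
      using norm_sum_over_n_le[of "\<lambda>n. chi (int n)" B m n] bound by simp
  next
    case False
    have "B \<ge> 0" using bound[of 0] by simp
    with False show ?thesis by simp
  qed
  have "summable f"
    unfolding summable_Cauchy
  proof (intro allI impI)
    fix e :: real assume "e > 0"
    have "(\<lambda>m. 2 * B / real (Suc m)) \<longlonglongrightarrow> 0" by real_asymp
    hence "\<forall>\<^sub>F m in sequentially. 2 * B / real (Suc m) < e"
      using \<open>e > 0\<close> by (rule order_tendstoD)
    then obtain N where "\<And>m. m \<ge> N \<Longrightarrow> 2 * B / real (Suc m) < e"
      by (auto simp: eventually_sequentially)
    thus "\<exists>N. \<forall>m\<ge>N. \<forall>n. norm (sum f {m..<n}) < e" using tail by (meson le_less_trans)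
  qed
  hence "(\<lambda>M. norm (sum f {..<M})) \<longlonglongrightarrow> norm (suminf f)"
    by (intro tendsto_norm summable_LIMSEQ)
  moreover have "\<forall>\<^sub>F M in sequentially. norm (sum f {..<M})
      \<le> (\<Sum>n=1..N. norm (chi (int n)) / real n) + 2 * B / real (Suc N)"
    using eventually_ge_at_top[of N]
  proof eventually_elim
    case (elim M)
    have "{..<M} = {0..<N} \<union> {N..<M}" using elim by auto
    hence "sum f {..<M} = sum f {0..<N} + sum f {N..<M}"
      by (simp add: sum.union_disjoint)
    hence "norm (sum f {..<M}) \<le> norm (sum f {0..<N}) + 2 * B / real (Suc N)"
      using tail[of N M] norm_triangle_ineq[of "sum f {0..<N}" "sum f {N..<M}"] by simp
    also have "norm (sum f {0..<N}) \<le> (\<Sum>n=1..N. norm (chi (int n)) / real n)"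
      unfolding sum_f One_nat_def by (rule sum_norm_le) (simp add: norm_divide)
    finally show ?case by simp
  qed
  ultimately have "norm (suminf f) \<le> (\<Sum>n=1..N. norm (chi (int n)) / real n) + 2 * B / real (Suc N)"
    by (intro tendsto_upperbound) auto
  moreover have "Dirichlet_L 1 chi = suminf f" unfolding Dirichlet_L_def f_def ..
  ultimately show ?thesis by simp
qed

lemma sum_norm_character_over_n:
  assumes "dirichlet_character q chi" "q > 0" "x \<ge> 0"
  shows "(\<Sum>n=1..nat \<lfloor>x\<rfloor>. norm (chi (int n)) / real n) = (\<Sum>n\<in>sifted (prime_factors q) x. 1 / real n)"
proof (rule sum.mono_neutral_cong_right)
  have cop: "coprime n q \<longleftrightarrow> (\<forall>p\<in>prime_factors q. \<not> p dvd n)" for n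
  proof
    assume "coprime n q"
    thus "\<forall>p\<in>prime_factors q. \<not> p dvd n"
      by (metis coprime_common_divisor_nat in_prime_factors_iff not_prime_1 nat_dvd_1_iff_1)
  next
    assume *: "\<forall>p\<in>prime_factors q. \<not> p dvd n"
    show "coprime n q"
    proof (rule ccontr)
      assume "\<not> coprime n q"
      hence "gcd n q \<noteq> 1" by (simp add: coprime_iff_gcd_eq_1)
      then obtain p where "prime p" "p dvd gcd n q" using prime_factor_nat by blast
      thus False using * assms(2) by (auto simp: in_prime_factors_iff)
    qed
  qed
  have floor: "n \<le> nat \<lfloor>x\<rfloor> \<longleftrightarrow> real n \<le> x" for n
    using assms(3) by (simp add: le_nat_iff le_floor_iff)
  show "sifted (prime_factors q) x \<subseteq> {1..nat \<lfloor>x\<rfloor>}"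
    by (auto simp: sifted_def floor)
  show "\<forall>n\<in>{1..nat \<lfloor>x\<rfloor>} - sifted (prime_factors q) x. norm (chi (int n)) / real n = 0"
  proof
    fix n assume "n \<in> {1..nat \<lfloor>x\<rfloor>} - sifted (prime_factors q) x"
    hence "\<not> coprime n q" unfolding cop by (auto simp: sifted_def floor)
    thus "norm (chi (int n)) / real n = 0"
      using norm_dirichlet_character[OF assms(1,2), of "int n"] by simp
  qed
  show "norm (chi (int n)) / real n = 1 / real n" if "n \<in> sifted (prime_factors q) x" for n
  proof -
    have "coprime n q" using that unfolding cop by (auto simp: sifted_def)
    thus ?thesis using norm_dirichlet_character[OF assms(1,2), of "int n"] by simp
  qed
qed simp

lemma totient_over_eq_prime_prod:
  "q > 0 \<Longrightarrow> real (totient q) / real q = prime_prod (prime_factors q)"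
  by (simp add: totient_formula2 prime_prod_def)

text \<open>Lets error terms of size \<open>1 / ln q\<close> be absorbed into the factor
  \<open>totient q / q\<close>. The number \<open>w\<close> of prime factors is at most
  \<open>1 + ln q\<close>, and the product over them is at least \<open>1 / (w + 1)\<close>.\<close>

lemma one_over_ln_le_totient:
  assumes "q \<ge> 3"
  shows "1 / ln (real q) \<le> 3 * (real (totient q) / real q)"
proof -
  define y where "y = ln (real q)"
  have y: "y \<ge> 1" using ln_gt_1[OF assms] by (simp add: y_def)
  let ?w = "card (prime_factors q)"
  have "ln (2 ^ ?w) \<le> ln (2 * sqrt (real q))"
    using two_power_card_prime_factors_le[of q] assms by (intro ln_mono) auto
  hence "real ?w * ln 2 \<le> ln 2 + y / 2"
    using assms by (simp add: ln_realpow ln_mult ln_sqrt y_def)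
  also have "\<dots> \<le> (1 + y) * ln 2"
    using ln2_ge_two_thirds y by (simp add: algebra_simps)
  finally have "real ?w \<le> 1 + y" by simp
  hence "1 / (3 * y) \<le> 1 / (real ?w + 1)" using y by (intro divide_left_mono) auto
  also have "\<dots> \<le> prime_prod (prime_factors q)" by (rule prime_prod_ge) auto
  also have "\<dots> = real (totient q) / real q" using assms by (simp add: totient_over_eq_prime_prod)
  finally show ?thesis using y by (simp add: y_def field_simps)
qed

lemma norm_Dirichlet_L_1_le_totient:
  assumes chi: "chi \<in> nonprincipal_characters q" and q: "q \<ge> 3"
  shows "norm (Dirichlet_L 1 chi)
           \<le> (real (totient q) / real q) * (ln (real q) / 2 + 7 * ln (ln (real q)) + 66)"
proof -
  define y where "y = ln (real q)"
  have y: "y \<ge> 1" using ln_gt_1[OF q] by (simp add: y_def)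
  define \<Phi> where "\<Phi> = real (totient q) / real q"
  have \<Phi>: "\<Phi> = prime_prod (prime_factors q)" "\<Phi> \<ge> 0"
    using q by (simp_all add: \<Phi>_def totient_over_eq_prime_prod[symmetric])
  \<comment> \<open>The factor \<open>sqrt q\<close> matches both the Polya-Vinogradov bound and
    \<open>2 ^ card (prime_factors q)\<close>; the cube of \<open>y\<close> makes both errors
    \<open>O(1 / y)\<close> and costs only \<open>3 * ln y\<close> in \<open>ln x\<close>.\<close>
  define x where "x = sqrt (real q) * y ^ 3"
  have x: "x > 0" using q y by (simp add: x_def)
  have sq: "sqrt (real q) > 0" using q by simp
  define N where "N = nat \<lfloor>x\<rfloor>"
  define B where "B = 4 * sqrt (real q) * (1 + y)"
  have dc: "dirichlet_character q chi" using chi by (simp add: nonprincipal_characters_def)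
  have "norm (Dirichlet_L 1 chi) \<le> (\<Sum>n=1..N. norm (chi (int n)) / real n) + 2 * B / real (Suc N)"
    unfolding B_def y_def using q by (intro norm_Dirichlet_L_1_le polya_vinogradov chi) auto
  also have "(\<Sum>n=1..N. norm (chi (int n)) / real n) = (\<Sum>n\<in>sifted (prime_factors q) x. 1 / real n)"
    unfolding N_def using q x dc by (intro sum_norm_character_over_n) auto
  also have "2 * B / real (Suc N) \<le> 16 / y"
  proof -
    have "x \<le> real (Suc N)" unfolding N_def using x by linarith
    hence "2 * B / real (Suc N) \<le> 2 * B / x"
      using x y by (intro divide_left_mono) (auto simp: B_def)
    also have "\<dots> = 8 * (1 + y) / y ^ 3" using sq by (simp add: B_def x_def)
    also have "\<dots> \<le> 8 * (2 * y) / y ^ 3" using y by (intro divide_right_mono) auto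
    also have "\<dots> = 16 / y * (1 / y)" using y by (simp add: power3_eq_cube)
    also have "\<dots> \<le> 16 / y * 1" using y by (intro mult_left_mono) auto
    finally show ?thesis by simp
  qed
  also have "(\<Sum>n\<in>sifted (prime_factors q) x. 1 / real n)
      \<le> \<Phi> * (ln x + euler_mascheroni + prime_log_sum (prime_factors q)) + 4 / y"
  proof -
    have "2 ^ card (prime_factors q) * (2 / x) \<le> 2 * sqrt (real q) * (2 / x)"
      using x q by (intro mult_right_mono two_power_card_prime_factors_le) auto
    also have "\<dots> = 4 / y * (1 / y ^ 2)" using sq y by (simp add: x_def power3_eq_cube power2_eq_square)
    also have "\<dots> \<le> 4 / y * 1" using y by (intro mult_left_mono) auto
    finally have "2 ^ card (prime_factors q) * (2 / x) \<le> 4 / y" by simp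
    moreover have "\<bar>(\<Sum>n\<in>sifted (prime_factors q) x. 1 / real n)
        - \<Phi> * (ln x + euler_mascheroni + prime_log_sum (prime_factors q))\<bar>
        \<le> 2 ^ card (prime_factors q) * (2 / x)"
      unfolding \<Phi> using x by (intro sum_sifted_approx) auto
    ultimately show ?thesis by linarith
  qed
  also have "ln x = y / 2 + 3 * ln y"
    using y q by (simp add: x_def ln_mult ln_sqrt ln_realpow y_def)
  finally have 1: "norm (Dirichlet_L 1 chi)
      \<le> \<Phi> * (y / 2 + 3 * ln y + euler_mascheroni + prime_log_sum (prime_factors q)) + 20 / y"
    by simp
  \<comment> \<open>Here \<open>7 = 3 + 4\<close>, the 4 coming from \<open>prime_log_sum\<close>,
    and 6 covers its constant 5 and \<open>euler_mascheroni < 1\<close>.\<close>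
  have "\<Phi> * (y / 2 + 3 * ln y + euler_mascheroni + prime_log_sum (prime_factors q))
      \<le> \<Phi> * (y / 2 + 7 * ln y + 6)"
    using \<Phi>(2) prime_log_sum_prime_factors_le[OF q] euler_mascheroni_less_13_over_22
    by (intro mult_left_mono) (auto simp: y_def)
  \<comment> \<open>The errors \<open>16 / y\<close> and \<open>4 / y\<close> together; 60 and the 6
    above add up to the constant 66.\<close>
  moreover have "20 / y \<le> \<Phi> * 60"
    using mult_left_mono[OF one_over_ln_le_totient[OF q], of 20] by (simp add: \<Phi>_def y_def mult.commute)
  ultimately have "norm (Dirichlet_L 1 chi) \<le> \<Phi> * (y / 2 + 7 * ln y + 6) + \<Phi> * 60"
    using 1 by linarith
  thus ?thesis by (simp add: \<Phi>_def y_def algebra_simps)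
qed

lemma Dirichlet_L_1_bound:
  "\<exists>C::real. C > 0 \<and> (\<forall>q::nat. q \<ge> 3 \<longrightarrow> (\<forall>chi \<in> nonprincipal_characters q.
     norm (Dirichlet_L 1 chi)
       \<le> (1 / 2 + C * (ln (ln (real q)) / ln (real q))) * (real (totient q) / real q) * ln (real q)))"
proof -
  \<comment> \<open>Since \<open>ln (ln q) \<ge> k > 0\<close> for \<open>q \<ge> 3\<close>, the
    constant 66 is at most \<open>66 / k * ln (ln q)\<close>.\<close>
  define k :: real where "k = ln (ln 3)"
  have k: "k > 0" using ln_3_gt_1 by (simp add: k_def)
  show ?thesis
  proof (intro exI[of _ "7 + 66 / k"] conjI allI impI ballI)
    show "7 + 66 / k > 0" using k by (simp add: add_pos_pos)
    fix q :: nat and chi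
    assume q: "q \<ge> 3" and chi: "chi \<in> nonprincipal_characters q"
    define y where "y = ln (real q)"
    have y3: "y \<ge> ln 3" using q by (simp add: y_def)
    hence y: "y > 0" using ln_gt_zero[of "3::real"] by linarith
    have "ln y \<ge> k" unfolding k_def using y3 y by (subst ln_le_cancel_iff) auto
    hence "66 / k * k \<le> 66 / k * ln y" using k by (intro mult_left_mono) auto
    hence "66 \<le> 66 / k * ln y" using k by simp
    hence "y / 2 + 7 * ln y + 66 \<le> y / 2 + (7 + 66 / k) * ln y" by (simp only: distrib_right)
    hence "(real (totient q) / real q) * (y / 2 + 7 * ln y + 66)
        \<le> (real (totient q) / real q) * (y / 2 + (7 + 66 / k) * ln y)"
      by (intro mult_left_mono) auto
    also have "\<dots> = (1 / 2 + (7 + 66 / k) * (ln y / y)) * (real (totient q) / real q) * y"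
    proof -
      have "y / 2 + c * ln y = (1 / 2 + c * (ln y / y)) * y" for c
        using y by (simp add: distrib_right)
      thus ?thesis by simp
    qed
    finally show "norm (Dirichlet_L 1 chi)
       \<le> (1 / 2 + (7 + 66 / k) * (ln (ln (real q)) / ln (real q))) * (real (totient q) / real q) * ln (real q)"
      using norm_Dirichlet_L_1_le_totient[OF chi q] by (simp only: y_def)
  qed
qed

subsection \<open>The limit inferior along primorials\<close>

text \<open>The witness is the quadratic character modulo 3, restricted to integers coprime to
  \<open>q\<close>. It guarantees that \<open>Max\<close> is not taken over an empty set.\<close>

lemma nonprincipal_characters_nonempty:
  assumes "3 dvd q"
  shows "nonprincipal_characters q \<noteq> {}"
proof -
  define chi :: "int \<Rightarrow> complex" where
    "chi n = (if coprime n (int q) then if n mod 3 = 1 then 1 else - 1 else 0)" for n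
  have q3: "3 dvd int q" using assms by presburger
  have m3: "n mod 3 = 1 \<or> n mod 3 = 2" if "coprime n (int q)" for n
  proof -
    have "\<not> 3 dvd n" using that q3 by (metis coprime_common_divisor zdvd1_eq abs_numeral numeral_eq_one_iff semiring_norm(86))
    thus ?thesis by presburger
  qed
  have "dirichlet_character q chi"
    unfolding dirichlet_character_def
  proof (intro conjI allI)
    show "chi (n + int q) = chi n" for n
    proof -
      have "coprime (n + int q) (int q) \<longleftrightarrow> coprime n (int q)"
        using gcd_add1[of n "int q"] by (simp only: coprime_iff_gcd_eq_1)
      moreover have "(n + int q) mod 3 = n mod 3" using q3 by presburger
      ultimately show ?thesis by (simp add: chi_def)
    qed
    show "chi (m * n) = chi m * chi n" for m n
    proof (cases "coprime m (int q) \<and> coprime n (int q)")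
      case True
      have "(m * n) mod 3 = ((m mod 3) * (n mod 3)) mod 3" by (simp add: mod_mult_eq)
      thus ?thesis using True m3[of m] m3[of n] by (auto simp: chi_def)
    qed (auto simp: chi_def)
    show "(chi n \<noteq> 0) = coprime n (int q)" for n by (simp add: chi_def)
  qed
  moreover have "chi \<noteq> principal_character q"
  proof
    assume "chi = principal_character q"
    hence "chi (- 1) = principal_character q (- 1)" by simp
    thus False by (simp add: chi_def principal_character_def)
  qed
  ultimately show ?thesis by (auto simp: nonprincipal_characters_def)
qed

definition primorial :: "nat \<Rightarrow> nat" where
  "primorial n = \<Prod>(primes_upto (real n))"

lemma primorial_pos: "primorial n > 0"
  unfolding primorial_def by (intro prod_pos) (auto simp: primes_upto_def prime_gt_0_nat)

lemma prime_factors_primorial: "prime_factors (primorial n) = primes_upto (real n)"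
proof -
  have "p \<in> prime_factors (primorial n) \<longleftrightarrow> p \<in> primes_upto (real n)" for p
  proof
    assume "p \<in> prime_factors (primorial n)"
    hence p: "prime p" "p dvd \<Prod>(primes_upto (real n))" by (auto simp: primorial_def)
    then obtain r where "r \<in> primes_upto (real n)" "p dvd r"
      using prime_dvd_prod_iff[of "primes_upto (real n)" p "\<lambda>x. x"] by auto
    thus "p \<in> primes_upto (real n)" using p(1) primes_dvd_imp_eq[of p r] prime_primes_upto by blast
  next
    assume p: "p \<in> primes_upto (real n)"
    hence "p dvd primorial n" unfolding primorial_def by (intro dvd_prodI) auto
    thus "p \<in> prime_factors (primorial n)"
      using p primorial_pos[of n] prime_primes_upto by (simp add: in_prime_factors_iff)
  qed
  thus ?thesis by blast
qed

lemma primorial_ge: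
  assumes "prime p" "p \<le> n"
  shows "p dvd primorial n" "p \<le> primorial n"
proof -
  have "p \<in> primes_upto (real n)" using assms by (simp add: primes_upto_def)
  thus *: "p dvd primorial n" unfolding primorial_def by (intro dvd_prodI) auto
  show "p \<le> primorial n" using * primorial_pos[of n] by (rule dvd_imp_le)
qed

lemma filterlim_primorial: "filterlim primorial at_top sequentially"
  unfolding filterlim_at_top
proof
  fix Z :: nat
  obtain p where p: "prime p" "p > Z" using bigger_prime by blast
  show "\<forall>\<^sub>F n in sequentially. Z \<le> primorial n"
    using eventually_ge_at_top[of p] 
  proof eventually_elim
    case (elim n)
    thus ?case using p(2) primorial_ge(2)[OF p(1) elim] by linarith
  qed
qed

text \<open>A trivial estimate is enough: only \<open>ln (ln (primorial n))\<close> matters, and it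
  becomes at most \<open>ln n + ln (ln n)\<close>, asymptotic to \<open>ln n\<close>.\<close>

lemma ln_primorial_le:
  assumes "n > 0"
  shows "ln (real (primorial n)) \<le> real n * ln (real n)"
proof -
  have sub: "primes_upto (real n) \<subseteq> {1..n}"
    by (auto simp: primes_upto_def prime_gt_0_nat Suc_le_eq)
  have "primorial n \<le> n ^ card (primes_upto (real n))"
    unfolding primorial_def by (rule prod_le_power) (use sub assms in auto)
  also have "\<dots> \<le> n ^ n"
    using card_mono[OF _ sub] assms by (intro power_increasing) auto
  finally have "real (primorial n) \<le> real (n ^ n)" by (simp only: of_nat_le_iff)
  hence "ln (real (primorial n)) \<le> ln (real n ^ n)"
    using primorial_pos[of n] by (intro ln_mono) auto
  thus ?thesis using assms by (simp add: ln_realpow)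
qed

text \<open>Dividing by \<open>ln q / ln (ln q)\<close> leaves
  \<open>totient q / q * ln (ln q)\<close>. For a primorial, \<open>totient q / q\<close> is the
  product over all primes up to \<open>n\<close>, below \<open>1 / (c * ln n)\<close> by assumption,
  and \<open>ln (ln q)\<close> exceeds \<open>ln n\<close> by at most
  \<open>ln (ln n)\<close>.\<close>

lemma Max_Dirichlet_L_primorial_le:
  fixes c C :: real
  assumes n: "n \<ge> 3" and c: "c > 0" "c * ln (real n) * prime_prod (primes_upto (real n)) < 1" and C: "C > 0"
    and L: "\<And>q chi. q \<ge> 3 \<Longrightarrow> chi \<in> nonprincipal_characters q \<Longrightarrow> norm (Dirichlet_L 1 chi)
       \<le> (1 / 2 + C * (ln (ln (real q)) / ln (real q))) * (real (totient q) / real q) * ln (real q)"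
  defines "q \<equiv> primorial n"
  shows "Max ((\<lambda>chi. norm (Dirichlet_L 1 chi) / (ln (real q) / ln (ln (real q)))) ` nonprincipal_characters q)
           \<le> (1 / 2 + C * (ln (ln (real q)) / ln (real q))) * ((1 + ln (ln (real n)) / ln (real n)) / c)"
proof -
  have three: "prime (3::nat)" by simp
  \<comment> \<open>Since \<open>n \<ge> 3\<close>, the prime 3 divides \<open>q\<close>, which
    supplies a non-principal character.\<close>
  have q3: "q \<ge> 3" "3 dvd q" using primorial_ge[OF three n] by (simp_all add: q_def)
  define y where "y = ln (real q)"
  have y: "y > 1" using ln_gt_1[OF q3(1)] by (simp add: y_def)
  have lny: "ln y > 0" using y by simp
  have ln_n: "ln (real n) > 1" using ln_gt_1[OF n] .
  define \<Phi> where "\<Phi> = prime_prod (primes_upto (real n))"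
  have tot: "real (totient q) / real q = \<Phi>"
    using q3 by (subst totient_over_eq_prime_prod) (auto simp: \<Phi>_def q_def prime_factors_primorial)
  have \<Phi>0: "\<Phi> \<ge> 0" unfolding tot[symmetric] by simp
  have "ln y \<le> ln (real n * ln (real n))"
    using ln_primorial_le[of n] n y by (intro ln_mono) (auto simp: y_def q_def)
  also have "\<dots> = ln (real n) + ln (ln (real n))" using n ln_n by (simp add: ln_mult)
  also have "\<dots> = ln (real n) * (1 + ln (ln (real n)) / ln (real n))"
    using ln_n by (simp add: distrib_left)
  finally have "\<Phi> * ln y \<le> \<Phi> * (ln (real n) * (1 + ln (ln (real n)) / ln (real n)))"
    using \<Phi>0 by (intro mult_left_mono)
  also have "\<dots> = (ln (real n) * \<Phi>) * (1 + ln (ln (real n)) / ln (real n))" by simp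
  also have "\<dots> \<le> (1 / c) * (1 + ln (ln (real n)) / ln (real n))"
  proof (rule mult_right_mono)
    show "ln (real n) * \<Phi> \<le> 1 / c" using c by (simp add: \<Phi>_def field_simps)
    show "1 + ln (ln (real n)) / ln (real n) \<ge> 0" using ln_n by simp
  qed
  finally have \<Phi>y: "\<Phi> * ln y \<le> (1 + ln (ln (real n)) / ln (real n)) / c" by simp
  have "norm (Dirichlet_L 1 chi) / (y / ln y)
      \<le> (1 / 2 + C * (ln y / y)) * ((1 + ln (ln (real n)) / ln (real n)) / c)"
    if chi: "chi \<in> nonprincipal_characters q" for chi
  proof -
    have "norm (Dirichlet_L 1 chi) / (y / ln y) \<le> ((1 / 2 + C * (ln y / y)) * \<Phi> * y) / (y / ln y)"
      using L[OF q3(1) chi] y lny unfolding tot y_def[symmetric] by (intro divide_right_mono) auto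
    also have "\<dots> = (1 / 2 + C * (ln y / y)) * (\<Phi> * ln y)" using y by simp
    also have "\<dots> \<le> (1 / 2 + C * (ln y / y)) * ((1 + ln (ln (real n)) / ln (real n)) / c)"
      using \<Phi>y C y lny by (intro mult_left_mono) auto
    finally show ?thesis .
  qed
  moreover have "finite (nonprincipal_characters q)"
    using finite_dirichlet_characters[of q] q3(1)
    by (auto simp: nonprincipal_characters_def intro: finite_subset[rotated])
  moreover have "nonprincipal_characters q \<noteq> {}" by (rule nonprincipal_characters_nonempty[OF q3(2)])
  ultimately show ?thesis unfolding y_def[symmetric] by (subst Max_le_iff) auto
qed

theorem theorem1p1:
  "(\<exists>C::real. C > 0 \<and>
      (\<forall>q::nat. q \<ge> 3 \<longrightarrow> (\<forall>chi \<in> nonprincipal_characters q.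
         cmod (Dirichlet_L 1 chi)
           \<le> (1 / 2 + C * (ln (ln (real q)) / ln (real q))) * (real (totient q) / real q) * ln (real q))))
   \<and>
   Liminf sequentially
     (\<lambda>q::nat. ereal (Max ((\<lambda>chi. cmod (Dirichlet_L 1 chi) / (ln (real q) / ln (ln (real q))))
                             ` nonprincipal_characters q)))
     \<le> ereal (1 / 2 * exp (- (euler_mascheroni :: real)))"
proof (intro conjI Dirichlet_L_1_bound)
  obtain C :: real where C: "C > 0" "\<And>q chi. q \<ge> 3 \<Longrightarrow> chi \<in> nonprincipal_characters q \<Longrightarrow>
      norm (Dirichlet_L 1 chi)
       \<le> (1 / 2 + C * (ln (ln (real q)) / ln (real q))) * (real (totient q) / real q) * ln (real q)"
    using Dirichlet_L_1_bound by blast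
  define h where "h q = Max ((\<lambda>chi. cmod (Dirichlet_L 1 chi) / (ln (real q) / ln (ln (real q))))
                             ` nonprincipal_characters q)" for q :: nat
  have "Liminf sequentially (\<lambda>q. ereal (h q)) \<le> ereal (1 / 2 * exp (- (euler_mascheroni :: real)))"
  proof (rule ccontr)
    assume "\<not> ?thesis"
    then obtain r where r: "1 / 2 * exp (- (euler_mascheroni :: real)) < r"
        "ereal r < Liminf sequentially (\<lambda>q. ereal (h q))"
      using ereal_dense2 by (force simp: not_le)
    have ev_h: "\<forall>\<^sub>F q in sequentially. r < h q" using less_LiminfD[OF r(2)] by simp
    have r0: "r > 0" by (rule less_trans[OF _ r(1)]) simp
    have "1 / (2 * r) < exp euler_mascheroni"
      using r(1) r0 by (simp add: exp_minus field_simps)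
    \<comment> \<open>Choosing \<open>c\<close> in this gap makes the limiting bound
      \<open>1 / (2 * c)\<close> smaller than \<open>r\<close>.\<close>
    then obtain c where c: "1 / (2 * r) < c" "c < exp euler_mascheroni" using dense by blast
    have c0: "c > 0" by (rule less_trans[OF _ c(1)]) (use r0 in simp)
    have "(\<lambda>q::nat. ln (ln (real q)) / ln (real q)) \<longlonglongrightarrow> 0" by real_asymp
    hence "(\<lambda>n. ln (ln (real (primorial n))) / ln (real (primorial n))) \<longlonglongrightarrow> 0"
      by (rule filterlim_compose[OF _ filterlim_primorial])
    moreover have "(\<lambda>n::nat. ln (ln (real n)) / ln (real n)) \<longlonglongrightarrow> 0" by real_asymp
    ultimately have "(\<lambda>n. (1 / 2 + C * (ln (ln (real (primorial n))) / ln (real (primorial n))))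
        * ((1 + ln (ln (real n)) / ln (real n)) / c)) \<longlonglongrightarrow> (1 / 2 + C * 0) * ((1 + 0) / c)"
      using c0 by (intro tendsto_intros) auto
    moreover have "(1 / 2 + C * 0) * ((1 + 0) / c) < r" using c(1) c0 r0 by (simp add: field_simps)
    ultimately have "\<forall>\<^sub>F n in sequentially. (1 / 2 + C * (ln (ln (real (primorial n))) / ln (real (primorial n))))
        * ((1 + ln (ln (real n)) / ln (real n)) / c) < r"
      by (rule order_tendstoD(2))
    moreover have "\<forall>\<^sub>F n in sequentially. r < h (primorial n)"
      using ev_h filterlim_primorial by (rule eventually_compose_filterlim)
    ultimately have "\<forall>\<^sub>F n in sequentially. (1 / 2 + C * (ln (ln (real (primorial n))) / ln (real (primorial n))))
        * ((1 + ln (ln (real n)) / ln (real n)) / c) < h (primorial n)"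
      by eventually_elim simp
    then obtain M where M: "\<And>n. n \<ge> M \<Longrightarrow> (1 / 2 + C * (ln (ln (real (primorial n))) / ln (real (primorial n))))
        * ((1 + ln (ln (real n)) / ln (real n)) / c) < h (primorial n)"
      by (auto simp: eventually_sequentially)
    \<comment> \<open>The Mertens-type bound holds for some \<open>n\<close> beyond
      \<open>M\<close>, and there the upper and lower bounds for \<open>h (primorial n)\<close>
      collide.\<close>
    obtain n where n: "n \<ge> max M 3" "c * ln (real n) * prime_prod (primes_upto (real n)) < 1"
      using frequently_euler_product_gt[OF c(2)] by blast
    have "h (primorial n) \<le> (1 / 2 + C * (ln (ln (real (primorial n))) / ln (real (primorial n))))
        * ((1 + ln (ln (real n)) / ln (real n)) / c)"
      unfolding h_def using n c0 C by (intro Max_Dirichlet_L_primorial_le) auto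
    with M[of n] n show False by simp
  qed
  thus "Liminf sequentially
     (\<lambda>q::nat. ereal (Max ((\<lambda>chi. cmod (Dirichlet_L 1 chi) / (ln (real q) / ln (ln (real q))))
                             ` nonprincipal_characters q)))
     \<le> ereal (1 / 2 * exp (- (euler_mascheroni :: real)))"
    by (simp only: h_def)
qed

end
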